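(* Let $X_1,\ldots,X_n$ be independent random variables with values in a Polish space $\mathcal{X}$, and let $\mathcal{S}$ be a nonempty countable class of measurable functions $s=(s^1,\ldots,s^n)$ from $\mathcal{X}$ into $[-1,1]^n$. Suppose that $\mathbb{E}(s^k(X_k))=0$ for any $s=(s^1,\ldots,s^n)\in\mathcal{S}$ and any integer $k\in[1,n]$. Let $S_n(s)=s^1(X_1)+\cdots+s^n(X_n)$, $Z=\sup\{S_n(s):s\in\mathcal{S}\}$, $V_n=\sup_{s\in\mathcal{S}}\operatorname{Var}S_n(s)$, and let $L(t)=\log\mathbb{E}(\exp(tZ))$. Then: (a) for any $t>0$, $$L(t)\le t\,\mathbb{E}(Z)+\frac{t}{2}\bigl(2\mathbb{E}(Z)+V_n\bigr)\Bigl(\exp\bigl((e^{2t}-1)/2\bigr)-1\Bigr).$$ Consequently, setting $v=2\mathbb{E}(Z)+V_n$, for any $x>0$: (b) $$\mathbb{P}(Z\ge\mathbb{E}(Z)+x)\le\exp\Bigl(-\frac{x}{4}\log\bigl(1+2\log(1+x/v)\bigr)\Bigr);$$ (c) $$\mathbb{P}(Z\ge\mathbb{E}(Z)+x)\le\exp\Bigl(-\frac{x^2}{v+\sqrt{v^2+3vx}+(3x/2)}\Bigr)\le\exp\Bigl(-\frac{x^2}{2v+3x}\Bigr).$$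
   Context: Each component $s^k$ is a measurable function from $\mathcal{X}$ into $[-1,1]$. The variables $X_k$ need not be identically distributed. In (b), if $v=0$ then $x/v$ is read as $+\infty$ and the right-hand side as $0$. *)

theory Defs
  imports "HOL-Probability.Probability"
begin

text \<open>
  A function \<open>s = (s\<^sup>1, \<dots>, s\<^sup>n)\<close> into \<open>[-1,1]\<^sup>n\<close> is encoded by its components
  \<open>s k\<close> for \<open>k \<in> {1..n}\<close>; the values of \<open>s\<close> at other indices are ignored throughout.
\<close>

definition component_class :: "nat \<Rightarrow> (nat \<Rightarrow> 'a::topological_space \<Rightarrow> real) set \<Rightarrow> bool" where
  "component_class n \<S> \<longleftrightarrow>
     countable \<S> \<and> \<S> \<noteq> {} \<and>
     (\<forall>s\<in>\<S>. \<forall>k\<in>{1..n}. s k \<in> borel_measurable borel \<and> (\<forall>x. s k x \<in> {-1..1}))"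

definition partial_sum ::
    "nat \<Rightarrow> (nat \<Rightarrow> 'w \<Rightarrow> 'a) \<Rightarrow> (nat \<Rightarrow> 'a \<Rightarrow> real) \<Rightarrow> 'w \<Rightarrow> real" where
  "partial_sum n X s \<omega> = (\<Sum>k=1..n. s k (X k \<omega>))"

text \<open>
  The real-valued suprema below are over nonempty bounded sets whenever
  \<^term>\<open>component_class n \<S>\<close> holds (over a probability space for the second one), as
  \<open>\<bar>partial_sum n X s \<omega>\<bar> \<le> n\<close>.
\<close>

definition sup_sum ::
    "nat \<Rightarrow> (nat \<Rightarrow> 'w \<Rightarrow> 'a) \<Rightarrow> (nat \<Rightarrow> 'a \<Rightarrow> real) set \<Rightarrow> 'w \<Rightarrow> real" where
  "sup_sum n X \<S> \<omega> = (SUP s\<in>\<S>. partial_sum n X s \<omega>)"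

definition max_variance ::
    "'w measure \<Rightarrow> nat \<Rightarrow> (nat \<Rightarrow> 'w \<Rightarrow> 'a) \<Rightarrow> (nat \<Rightarrow> 'a \<Rightarrow> real) set \<Rightarrow> real" where
  "max_variance M n X \<S> = (SUP s\<in>\<S>. prob_space.variance M (partial_sum n X s))"

definition log_laplace :: "'w measure \<Rightarrow> ('w \<Rightarrow> real) \<Rightarrow> real \<Rightarrow> real" where
  "log_laplace M Z t = ln (prob_space.expectation M (\<lambda>\<omega>. exp (t * Z \<omega>)))"

end

theory Submission
  imports Defs
begin

text \<open>
  The entropy method. Let \<open>f = exp (t * Z)\<close> and let \<open>E\<^sub>k\<close> integrate out the \<open>k\<close>-th
  coordinate. Tensorization bounds the entropy of \<open>f\<close> by the sum over \<open>k\<close> of the expectations of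
  \<open>f * q\<close>, where \<open>q = ln (f / E\<^sub>k f)\<close>. For a finite class let \<open>s\<close> be a maximiser and \<open>a = t * s k (x k)\<close>,
  so that \<open>q \<le> a\<close>. Let \<open>g\<close> be the average of truncated versions of \<open>exp (t * S\<^sub>n(s))\<close> under the
  conditional law of the maximiser given the other coordinates. Then \<open>g \<le> f\<close>, and with
  \<open>\<alpha> = t * exp t / (1 + t * exp t)\<close> the part \<open>(f - g) * q\<close> is at most
  \<open>(f - g) * max \<alpha> a\<close>, while \<open>g * q\<close> is controlled by duality through the individual variances,
  because given the other coordinates the weights in \<open>g\<close> do not depend on \<open>x k\<close>. Since the \<open>a\<close> sum
  to \<open>t * Z\<close>, this gives the differential inequality
  \<open>t * L' - L \<le> exp (2 * t) * (t * L + t\<^sup>2 * V / 2)\<close>, whose integration is (a). The tail bounds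
  follow from Markov's inequality at \<open>t = ln (1 + 2 * ln (1 + x / v)) / 2\<close> for (b), and, using
  \<open>exp ((exp (2 * t) - 1) / 2) - 1 \<le> 2 * t / (2 - 3 * t)\<close>, at the optimal \<open>t\<close> for (c).
\<close>

section \<open>Real inequalities\<close>

text \<open>The bound \<open>q \<le> a\<close> alone is empty: summed over \<open>k\<close> it says
  that the entropy of \<open>f\<close> is at most \<open>t\<close> times the expectation of
  \<open>Z * f\<close>, which only restates \<open>L \<ge> 0\<close>. The gain comes from
  \<open>g\<close>. Its weights and the factor without the \<open>k\<close>-th component are
  constant in \<open>x k\<close>, so duality against the conditional density
  \<open>f / E\<^sub>k f\<close> brings in the centering and the variance. At a maximiser everything
  then reduces to one inequality between the numbers \<open>a\<close> and
  \<open>t\<^sup>2 * Var / 2\<close>, where \<open>Var\<close> is the variance of the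
  \<open>k\<close>-th component. Its constant \<open>K = t * exp t\<close> is the maximum of
  \<open>a * exp a\<close> over \<open>a \<le> t\<close>, and \<open>\<alpha> = K / (1 + K)\<close>
  is the matching truncation level. The entropy comes with the factor \<open>1 + K\<close> and the
  increments with \<open>K\<close>, so the terms in \<open>L'\<close> cancel except for one
  \<open>t * L'\<close>. What remains is \<open>t * exp t * L\<close>; enlarging it to
  \<open>exp (2 * t) * t * L\<close> gives both terms on the right the common factor
  \<open>exp (2 * t)\<close>, whose primitive is explicit.\<close>

lemma exp_ge_partial_sum:
  fixes x :: real
  assumes "0 \<le> x"
  shows "(\<Sum>i<n. x ^ i / fact i) \<le> exp x"
proof -
  have "(\<Sum>i<n. x ^ i /\<^sub>R fact i) \<le> (\<Sum>i. x ^ i /\<^sub>R fact i)"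
    using assms by (intro sum_le_suminf summable_exp_generic) auto
  then show ?thesis
    by (simp add: exp_def field_simps)
qed

section \<open>Exponential inequalities for a single increment\<close>

lemma one_plus_mul_exp_le:
  fixes t :: real
  assumes "0 \<le> t"
  shows "1 + t * exp t \<le> exp (2 * t)"
proof -
  have "1 + t * exp t \<le> (1 + t) * exp t"
    using assms by (simp add: algebra_simps)
  also have "\<dots> \<le> exp t * exp t"
    by (intro mult_right_mono) auto
  finally show ?thesis
    by (simp add: mult_exp_exp)
qed

text \<open>Up to the factor \<open>K / 2\<close> this is the case \<open>b = t\<close> of
  \<open>negative_increment_small\<close>. The quartic Taylor polynomial of \<open>exp\<close>
  suffices up to \<open>5/4\<close>; from \<open>t = 2\<close> on the claim is false, since then
  \<open>2 - t \<le> 0\<close>.\<close>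

lemma exp_lower_bound_small:
  fixes t :: real
  assumes "0 \<le> t" "t \<le> 5/4"
  shows "2 + 3 * t \<le> exp t * ((2 - t) * (1 + t))"
proof -
  have e: "1 + t + t^2/2 + t^3/6 + t^4/24 \<le> exp t"
    using exp_ge_partial_sum[OF assms(1), of 5] by (simp add: eval_nat_numeral)
  have "0 \<le> t^2 * (2 + t - t^2) * (1/2 + t/6 + t^2/24) - t^3"
  proof -
    \<comment> \<open>\<open>27/16\<close> is the value at \<open>t = 5/4\<close>, the minimum of
      this concave quadratic on the interval.\<close>
    have q: "2 + t - t\<^sup>2 \<ge> 27/16"
    proof -
      have "(5/4 - t) * (t + 1/4) \<ge> 0" using assms by (intro mult_nonneg_nonneg) auto
      then show ?thesis by (simp add: algebra_simps power2_eq_square)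
    qed
    \<comment> \<open>Cleared of denominators, this is
      \<open>9 * t\<^sup>2 - 92 * t + 108 \<ge> 0\<close>. The product below, with the nearby round
      roots \<open>5/4\<close> and \<open>9\<close>, is a lower bound for it after scaling by
      \<open>9/4\<close>.\<close>
    have "27/16 * (1/2 + t/6 + t\<^sup>2/24) \<ge> t"
    proof -
      have "(4 * t - 5) * (t - 9) \<ge> 0"
        using assms by (intro mult_nonpos_nonpos) auto
      then have "t\<^sup>2 \<ge> 41/4 * t - 45/4" by (simp add: algebra_simps power2_eq_square)
      then show ?thesis using assms by (simp add: algebra_simps)
    qed
    moreover have "(2 + t - t\<^sup>2) * (1/2 + t/6 + t\<^sup>2/24) \<ge> 27/16 * (1/2 + t/6 + t\<^sup>2/24)"
      using q assms by (intro mult_right_mono) auto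
    ultimately have "(2 + t - t\<^sup>2) * (1/2 + t/6 + t\<^sup>2/24) \<ge> t" by linarith
    from mult_left_mono[OF this, of "t\<^sup>2"]
    have "t\<^sup>2 * t \<le> t\<^sup>2 * ((2 + t - t\<^sup>2) * (1/2 + t/6 + t\<^sup>2/24))" by simp
    moreover have "t ^ 3 = t\<^sup>2 * t" by (simp add: power2_eq_square power3_eq_cube)
    ultimately show ?thesis by (simp only: mult.assoc diff_ge_0_iff_ge)
  qed
  moreover have "(1 + t + t^2/2 + t^3/6 + t^4/24) * ((2 - t) * (1 + t)) =
      2 + 3 * t + (t^2 * (2 + t - t^2) * (1/2 + t/6 + t^2/24) - t^3)"
    by (simp add: field_simps eval_nat_numeral)
  ultimately have "2 + 3 * t \<le> (1 + t + t^2/2 + t^3/6 + t^4/24) * ((2 - t) * (1 + t))"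
    by linarith
  also have "\<dots> \<le> exp t * ((2 - t) * (1 + t))"
    using e assms by (intro mult_right_mono mult_nonneg_nonneg) auto
  finally show ?thesis .
qed

text \<open>Equivalent to \<open>1 + t \<le> exp t * (exp t - t - t\<^sup>2)\<close>. For small
  positive \<open>t\<close> it fails, as the cubic coefficients are \<open>3/2\<close> on the left
  and \<open>4/3\<close> on the right. At \<open>5/4\<close> both this bound and
  \<open>exp_lower_bound_small\<close> hold, each with little to spare; hence the split
  there.\<close>

lemma exp_lower_bound_large:
  fixes t :: real
  assumes "5/4 \<le> t"
  shows "(1 + t) * (1 + t * exp t) \<le> exp (2 * t)"
proof -
  define d where "d = t - 5/4"
  have d: "0 \<le> d" "t = 5/4 + d" using assms by (auto simp: d_def)
  have e1: "(348/100::real) \<le> exp (5/4)"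
    using exp_ge_partial_sum[of "5/4" 6] by (simp add: eval_nat_numeral)
  have e2: "1 + d + d^2/2 \<le> exp d"
    using exp_ge_partial_sum[OF d(1), of 3] by (simp add: eval_nat_numeral)
  have "348/100 * (1 + d + d^2/2) \<le> exp (5/4) * exp d"
    using e1 e2 d by (intro mult_mono) auto
  then have E: "348/100 * (1 + d + d^2/2) \<le> exp t"
    by (simp add: d mult_exp_exp)
  have E1: "66/100 + (0::real) \<le> exp t - t - t\<^sup>2"
  proof -
    have "0 \<le> 74/100 * (d - 1/74)\<^sup>2" by simp
    then show ?thesis using E d(1) unfolding d(2)
      by (simp add: algebra_simps power2_eq_square)
  qed
  have "1 + t \<le> (348/100 * (1 + d)) * (66/100)"
    using d by simp
  also have "\<dots> \<le> exp t * (exp t - t - t\<^sup>2)"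
  proof (intro mult_mono)
    show "348/100 * (1 + d) \<le> exp t" using E by (rule order_trans[rotated]) simp
  qed (use E1 in auto)
  finally show ?thesis
    by (simp add: algebra_simps power2_eq_square mult_exp_exp)
qed

text \<open>Let \<open>P\<close> be the right side. After division by \<open>exp b\<close> only
  \<open>(K * (1 + b) - P) * exp (- b)\<close> varies with \<open>b\<close>, and its derivative has
  the sign of \<open>P - K * b\<close>. For \<open>exp t \<ge> 2\<close> this is nonnegative on
  \<open>[0, t]\<close>, so \<open>b = t\<close> is the worst case. For \<open>exp t < 2\<close>
  low-order expansions are enough, and the claim comes down to
  \<open>(b - t)\<^sup>2 + t\<^sup>2 * (1 - t) \<ge> 0\<close>.\<close>

lemma negative_increment_small:
  fixes t b :: real
  assumes t: "0 \<le> t" "t \<le> 5/4" and b: "0 \<le> b" "b \<le> t"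
  defines "K \<equiv> t * exp t"
  shows "K * (1 + b - exp b) + exp b * (1 + K) * (t\<^sup>2 / 2) \<le> exp (2 * t) * (t\<^sup>2 / 2)"
proof (cases "exp t \<ge> 2")
  case True
  define P where "P = t\<^sup>2 / 2 * exp (2 * t)"
  have K: "0 \<le> K" using t by (simp add: K_def)
  have "t * exp t * (2 + 3 * t) \<le> t * exp t * (exp t * ((2 - t) * (1 + t)))"
    using t by (intro mult_left_mono exp_lower_bound_small) auto
  then have top: "K * (1 + t) + exp t * (1 + K) * (t\<^sup>2 / 2) - K * exp t \<le> P"
    unfolding K_def P_def exp_double by (simp add: algebra_simps power2_eq_square)
  have "t\<^sup>2 * exp t * 2 \<le> t\<^sup>2 * exp t * exp t"
    using True by (intro mult_left_mono) auto
  then have KP: "K * t \<le> P"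
    unfolding K_def P_def exp_double by (simp add: power2_eq_square algebra_simps)
  \<comment> \<open>The monotonicity without calculus: a nonnegative value at \<open>t\<close> is
    compared through \<open>1 + (b - t) \<le> exp (b - t)\<close>, a negative one only grows under a
    factor at most 1.\<close>
  have mono: "K * (1 + b) - P \<le> exp (b - t) * (K * (1 + t) - P)"
  proof (cases "K * (1 + t) - P \<ge> 0")
    case True
    have "K * (1 + b) - P \<le> (1 + (b - t)) * (K * (1 + t) - P)"
    proof -
      have "(t - b) * (K * (1 + t) - P) \<le> (t - b) * K"
        using KP b by (intro mult_left_mono) (auto simp: algebra_simps)
      then show ?thesis by (simp add: algebra_simps)
    qed
    also have "\<dots> \<le> exp (b - t) * (K * (1 + t) - P)"
      using True by (intro mult_right_mono) auto
    finally show ?thesis .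
  next
    case False
    have "K * (1 + b) - P \<le> K * (1 + t) - P"
      using K b by (simp add: mult_left_mono)
    also have "\<dots> = 1 * (K * (1 + t) - P)" by simp
    also have "\<dots> \<le> exp (b - t) * (K * (1 + t) - P)"
      using False b by (intro mult_right_mono_neg) auto
    finally show ?thesis .
  qed
  have "K * (1 + t) - P \<le> exp t * (K - (1 + K) * (t\<^sup>2 / 2))"
    using top by (simp add: algebra_simps)
  then have "exp (b - t) * (K * (1 + t) - P) \<le> exp (b - t) * (exp t * (K - (1 + K) * (t\<^sup>2 / 2)))"
    by (intro mult_left_mono) auto
  also have "\<dots> = exp b * (K - (1 + K) * (t\<^sup>2 / 2))"
    by (simp add: mult_exp_exp flip: mult.assoc)
  finally have "K * (1 + b) - P \<le> exp b * (K - (1 + K) * (t\<^sup>2 / 2))"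
    using mono by linarith
  moreover define T where "T = t\<^sup>2 / 2"
  ultimately show ?thesis unfolding P_def T_def[symmetric] by (simp add: algebra_simps)
next
  case False
  have t1: "t \<le> 1" using False exp_ge_add_one_self[of t] by linarith
  \<comment> \<open>Both \<open>1\<close> and \<open>exp (t - b)\<close> are traded for polynomials
    so that \<open>exp t\<close> factors out.\<close>
  have A: "exp b * (1 + K) - exp (2 * t) \<le> exp b * (exp t * (b - t + t\<^sup>2 / 2))"
  proof -
    have "exp (2 * t) = exp b * (exp t * exp (t - b))"
      by (simp add: mult_exp_exp)
    moreover have "exp t * exp (t - b) \<ge> exp t * (1 + (t - b))"
      by (intro mult_left_mono) auto
    moreover have "1 \<le> exp t * (1 - t + t\<^sup>2/2)"
    proof -
      have "(1 + t + t\<^sup>2/2) * (1 - t + t\<^sup>2/2) \<le> exp t * (1 - t + t\<^sup>2/2)"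
        using exp_lower_Taylor_quadratic[OF t(1)] t1 by (intro mult_right_mono) auto
      moreover have "(1 + t + t\<^sup>2/2) * (1 - t + t\<^sup>2/2) = 1 + (t\<^sup>2)\<^sup>2/4"
        by (simp add: algebra_simps power2_eq_square)
      moreover have "0 \<le> (t\<^sup>2)\<^sup>2" by simp
      ultimately show ?thesis by linarith
    qed
    ultimately have "1 + K - exp t * exp (t - b) \<le> exp t * (b - t + t\<^sup>2 / 2)"
      unfolding K_def by (simp add: algebra_simps)
    then have "exp b * (1 + K - exp t * exp (t - b)) \<le> exp b * (exp t * (b - t + t\<^sup>2 / 2))"
      by (intro mult_left_mono) auto
    then show ?thesis
      using \<open>exp (2 * t) = _\<close> by (simp add: algebra_simps)
  qed
  have B: "b\<^sup>2 / 2 \<le> exp b - 1 - b"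
    using exp_lower_Taylor_quadratic[OF b(1)] by simp
  have "(exp b * (1 + K) - exp (2 * t)) * (t\<^sup>2 / 2) \<le> K * (exp b - 1 - b)"
  proof (cases "b - t + t\<^sup>2 / 2 \<le> 0")
    case True
    then have "exp b * (exp t * (b - t + t\<^sup>2 / 2)) \<le> 0"
      by (simp add: mult_nonneg_nonpos)
    then have "(exp b * (1 + K) - exp (2 * t)) * (t\<^sup>2 / 2) \<le> 0"
      using A by (intro mult_nonpos_nonneg) auto
    also have "0 \<le> K * (exp b - 1 - b)"
      using B t unfolding K_def by (intro mult_nonneg_nonneg) (auto simp: algebra_simps)
    finally show ?thesis .
  next
    case pos: False
    have "exp b * (exp t * (b - t + t\<^sup>2 / 2)) \<le> 2 * (exp t * (b - t + t\<^sup>2 / 2))"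
      using False b pos by (intro mult_right_mono mult_nonneg_nonneg) (auto intro: order_trans[of _ "exp t"])
    then have "exp b * (1 + K) - exp (2 * t) \<le> 2 * (exp t * (b - t + t\<^sup>2 / 2))"
      using A by linarith
    then have "(exp b * (1 + K) - exp (2 * t)) * (t\<^sup>2 / 2) \<le> 2 * (exp t * (b - t + t\<^sup>2 / 2)) * (t\<^sup>2 / 2)"
      by (intro mult_right_mono) auto
    also have "\<dots> = K * (t * (b - t + t\<^sup>2 / 2))"
      unfolding K_def by (simp add: power2_eq_square)
    also have "\<dots> \<le> K * (b\<^sup>2 / 2)"
    proof (rule mult_left_mono)
      have "0 \<le> (b - t)\<^sup>2 + t\<^sup>2 * (1 - t)" using t1 by simp
      then show "t * (b - t + t\<^sup>2 / 2) \<le> b\<^sup>2 / 2"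
        by (simp add: algebra_simps power2_eq_square)
    qed (use t in \<open>auto simp: K_def\<close>)
    also have "\<dots> \<le> K * (exp b - 1 - b)"
      using B t by (intro mult_left_mono) (auto simp: K_def)
    finally show ?thesis .
  qed
  moreover define T where "T = t\<^sup>2 / 2"
  ultimately show ?thesis unfolding T_def[symmetric] by (simp add: algebra_simps)
qed

text \<open>The case \<open>a = - b\<close> of \<open>increment_bound\<close>. For
  \<open>t \<le> 5/4\<close> the positive part may be replaced by its argument; the claim is then
  affine in \<open>s\<close> and follows from \<open>s = 0\<close> and
  \<open>s = t\<^sup>2 / 2\<close>. For larger \<open>t\<close> the positive part \<open>r\<close>
  is kept: \<open>1 + b \<le> exp b\<close> takes care of \<open>r\<close>, and
  \<open>exp_lower_bound_large\<close> of \<open>K - r \<le> (1 + K) * s\<close>.\<close>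

lemma negative_increment:
  fixes t b s :: real
  assumes t: "0 < t" and b: "0 \<le> b" "b \<le> t" and s: "0 \<le> s" "s \<le> t\<^sup>2 / 2"
  defines "K \<equiv> t * exp t"
  shows "K * (1 + b) \<le> exp (2 * t) * s + exp b * max 0 (K - (1 + K) * s)"
proof (cases "t \<le> 5/4")
  case True
  define T where "T = t\<^sup>2 / 2"
  define l where "l = s / T"
  have l: "0 \<le> l" "l \<le> 1" "s = l * T"
    using s t by (auto simp: l_def T_def field_simps)
  have K: "0 \<le> K" using t by (simp add: K_def)
  have "0 \<le> (1 - l) * (K * (exp b - 1 - b))"
    using l K exp_ge_add_one_self[of b] by (intro mult_nonneg_nonneg) (auto simp: algebra_simps)
  moreover have "l * (K * (1 + b - exp b) + exp b * (1 + K) * T) \<le> l * (exp (2 * t) * T)"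
    unfolding K_def T_def using True t b l by (intro mult_left_mono negative_increment_small) auto
  ultimately have "K * (1 + b) \<le> exp (2 * t) * s + exp b * (K - (1 + K) * s)"
    unfolding l(3) by (simp add: algebra_simps)
  also have "\<dots> \<le> exp (2 * t) * s + exp b * max 0 (K - (1 + K) * s)"
    by simp
  finally show ?thesis .
next
  case False
  have K: "0 < K" using t by (simp add: K_def)
  define r where "r = max 0 (K - (1 + K) * s)"
  have r: "K - r \<le> (1 + K) * s" "0 \<le> r" "r \<le> K" using K s by (auto simp: r_def)
  have big: "(1 + t) * (1 + K) \<le> exp (2 * t)"
    using exp_lower_bound_large[of t] False by (simp add: K_def)
  have "(1 + b) * (K - r) \<le> (1 + t) * ((1 + K) * s)"
    using b r by (intro mult_mono) auto
  also have "\<dots> \<le> exp (2 * t) * s"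
    using mult_right_mono[OF big s(1)] by (simp add: mult.assoc)
  finally have "(1 + b) * (K - r) \<le> exp (2 * t) * s" .
  moreover have "(1 + b) * r \<le> exp b * r"
    using r by (intro mult_right_mono) auto
  ultimately show ?thesis unfolding r_def[symmetric] by (simp add: algebra_simps)
qed

text \<open>Here \<open>a\<close> is an increment and \<open>s\<close> half its variance. The first
  two terms on the left will come from \<open>f - g\<close>, the subtracted one from
  \<open>g\<close>. Where \<open>(1 + K) * a \<ge> K\<close> and \<open>s = 0\<close>, the claim
  reads \<open>a * exp a \<le> K\<close>, with equality at \<open>a = t\<close>; so no smaller
  \<open>K\<close> would do.\<close>

lemma increment_bound:
  fixes t a s :: real
  assumes t: "0 < t" and a: "\<bar>a\<bar> \<le> t" and s: "0 \<le> s" "s \<le> t\<^sup>2 / 2"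
  defines "K \<equiv> t * exp t"
  shows "K + max 0 ((1 + K) * a - K) - exp (- a) * max 0 (K - (1 + K) * s) \<le> K * a + exp (2 * t) * s"
proof (cases "a \<ge> 0")
  case False
  have K: "0 < K" using t by (simp add: K_def)
  have "(1 + K) * a \<le> 0" using False K by (intro mult_nonneg_nonpos) auto
  then have "max 0 ((1 + K) * a - K) = 0" using K by auto
  then show ?thesis
    using negative_increment[of t "- a" s] False assms by (simp add: algebra_simps)
next
  case True
  have K: "0 < K" using t by (simp add: K_def)
  have Ks: "(1 + K) * s \<le> exp (2 * t) * s"
    using one_plus_mul_exp_le[of t] t s by (intro mult_right_mono) (auto simp: K_def)
  have ea: "exp (- a) * ((1 + K) * s) \<le> 1 * ((1 + K) * s)"
    using True K s by (intro mult_right_mono) auto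
  define r where "r = max 0 (K - (1 + K) * s)"
  have r: "r \<ge> K - (1 + K) * s" by (simp add: r_def)
  have er: "exp (- a) * r \<ge> exp (- a) * K - exp (- a) * ((1 + K) * s)"
    using mult_left_mono[OF r, of "exp (- a)"] by (simp add: algebra_simps)
  show ?thesis unfolding r_def[symmetric]
  proof (cases "(1 + K) * a - K \<ge> 0")
    case pos: True
    have "a * exp a \<le> t * exp t" using a True by (intro mult_mono) auto
    then have "a \<le> exp (- a) * K" by (simp add: K_def exp_minus field_simps)
    then show "K + max 0 ((1 + K) * a - K) - exp (- a) * r \<le> K * a + exp (2 * t) * s"
      using pos er ea Ks by (simp add: algebra_simps)
  next
    case neg: False
    have "K * (1 - a) \<le> K * exp (- a)"
      using exp_ge_add_one_self[of "- a"] K by (intro mult_left_mono) auto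
    then show "K + max 0 ((1 + K) * a - K) - exp (- a) * r \<le> K * a + exp (2 * t) * s"
      using neg er ea Ks by (simp add: algebra_simps)
  qed
qed

text \<open>
  Among all \<open>\<rho> \<le> exp x\<close>, the value \<open>\<rho> = exp (min x \<alpha>)\<close> maximises
  \<open>(1 + \<alpha>) * \<rho> - \<rho> * ln \<rho> - 1\<close>.
\<close>

lemma truncated_exp_bound:
  fixes x \<alpha> :: real
  assumes \<alpha>: "0 \<le> \<alpha>"
  shows "\<alpha> + \<alpha> * x - x\<^sup>2 / 2 \<le> (1 + \<alpha> - min x \<alpha>) * exp (min x \<alpha>) - 1"
proof -
  \<comment> \<open>\<open>D\<close> is the difference of the two sides as long as
    \<open>x \<le> \<alpha>\<close>. Below \<open>\<alpha>\<close> its derivative changes sign only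
    at 0, where \<open>D\<close> vanishes.\<close>
  define D where "D y = (1 + \<alpha> - y) * exp y - 1 - \<alpha> - \<alpha> * y + y\<^sup>2 / 2" for y :: real
  have D0: "D 0 = 0" by (simp add: D_def)
  have der: "(D has_real_derivative (\<alpha> - y) * (exp y - 1)) (at y)" for y
    unfolding D_def by (auto intro!: derivative_eq_intros simp: algebra_simps)
  have D: "0 \<le> D y" if "y \<le> \<alpha>" for y
  proof (cases "y \<ge> 0")
    case True
    have "D 0 \<le> D y"
      by (rule DERIV_nonneg_imp_nondecreasing[OF True]) (use der that in \<open>force intro!: mult_nonneg_nonneg\<close>)
    then show ?thesis using D0 by simp
  next
    case False
    have "D y \<ge> D 0"
      by (rule DERIV_nonpos_imp_nonincreasing[of y 0])
        (use der that False \<alpha> in \<open>force intro!: mult_nonneg_nonpos\<close>)+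
    then show ?thesis using D0 by simp
  qed
  show ?thesis
  proof (cases "x \<le> \<alpha>")
    case True
    then show ?thesis using D[OF True] by (simp add: D_def)
  next
    case False
    \<comment> \<open>Beyond \<open>\<alpha>\<close> the right side is constant, while
      \<open>\<alpha> * x - x\<^sup>2 / 2\<close> is largest at \<open>x = \<alpha>\<close>.\<close>
    have "0 \<le> (x - \<alpha>)\<^sup>2" by simp
    then show ?thesis using D[of \<alpha>] False by (simp add: D_def power2_eq_square algebra_simps)
  qed
qed

text \<open>The Fenchel-Young inequality for \<open>exp\<close>, from the tangent at
  \<open>w = ln (A / B)\<close>, where equality holds. It is entropy duality in pointwise form, used
  both with \<open>B\<close> the conditional mean of \<open>A\<close> and with
  \<open>B = 1\<close>.\<close>

lemma young_exp:
  fixes A B w :: real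
  assumes "0 < A" "0 < B"
  shows "A * w \<le> A * ln (A / B) - A + B * exp w"
proof -
  define z where "z = w - ln (A / B)"
  have "A * (1 + z) \<le> A * exp z"
    using assms by (intro mult_left_mono) auto
  also have "A * exp z = B * exp w"
    using assms by (simp add: z_def exp_diff)
  finally show ?thesis by (simp add: z_def algebra_simps)
qed

text \<open>Equivalent to \<open>(exp (2 * t) - 1) / 2 \<le> ln ((2 - t) / (2 - 3 * t))\<close>.
  Both sides vanish at 0, and the derivatives compare because \<open>(1 - x / 2) * (1 - 3 * x / 2)
  \<le> exp (- x / 2) * exp (- 3 * x / 2) = exp (- 2 * x)\<close>.\<close>

lemma double_exp_bound:
  fixes t :: real
  assumes t: "0 \<le> t" "t < 2/3"
  shows "exp ((exp (2 * t) - 1) / 2) - 1 \<le> 2 * t / (2 - 3 * t)"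
proof -
  define h where "h x = ln (2 - x) - ln (2 - 3 * x) - (exp (2 * x) - 1) / 2" for x :: real
  have "h 0 \<le> h t"
  proof (rule DERIV_nonneg_imp_nondecreasing[OF t(1)])
    fix x assume x: "0 \<le> x" "x \<le> t"
    have "(h has_real_derivative (- 1 / (2 - x) + 3 / (2 - 3 * x) - exp (2 * x))) (at x)"
      unfolding h_def using x t by - (rule derivative_eq_intros refl | simp)+
    moreover have "0 \<le> - 1 / (2 - x) + 3 / (2 - 3 * x) - exp (2 * x)"
    proof -
      have "(1 - x / 2) * (1 - 3 * x / 2) \<le> exp (- x / 2) * exp (- 3 * x / 2)"
        using exp_ge_add_one_self[of "- x / 2"] exp_ge_add_one_self[of "- 3 * x / 2"] x t
        by (intro mult_mono) auto
      also have "\<dots> = exp (- (2 * x))"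
        by (simp add: mult_exp_exp)
      also have "\<dots> = 1 / exp (2 * x)"
        by (simp only: exp_minus inverse_eq_divide)
      finally have "exp (2 * x) \<le> 1 / ((1 - x / 2) * (1 - 3 * x / 2))"
        using x t by (simp add: pos_le_divide_eq mult.commute)
      also have "\<dots> = - 1 / (2 - x) + 3 / (2 - 3 * x)"
      proof -
        have "2 - x \<noteq> 0" "2 - 3 * x \<noteq> 0" using x t by auto
        then have *: "- 1 / (2 - x) + 3 / (2 - 3 * x) = 4 / ((2 - x) * (2 - 3 * x))"
          by (subst add_frac_eq) auto
        have **: "(1 - x / 2) * (1 - 3 * x / 2) = ((2 - x) * (2 - 3 * x)) / 4"
          by (simp add: field_simps)
        show ?thesis unfolding * ** by simp
      qed
      finally show ?thesis by simp
    qed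
    ultimately show "\<exists>y. (h has_real_derivative y) (at x) \<and> 0 \<le> y" by blast
  qed
  then have "(exp (2 * t) - 1) / 2 \<le> ln ((2 - t) / (2 - 3 * t))"
    using t by (simp add: h_def ln_div)
  then have "exp ((exp (2 * t) - 1) / 2) \<le> exp (ln ((2 - t) / (2 - 3 * t)))"
    by simp
  also have "\<dots> = (2 - t) / (2 - 3 * t)"
    using t by (intro exp_ln) auto
  also have "\<dots> = 1 + 2 * t / (2 - 3 * t)"
    using t by (simp add: field_simps)
  finally show ?thesis by simp
qed

section \<open>Tensorization of entropy\<close>

definition bounded_measurable :: "'b measure \<Rightarrow> ('b \<Rightarrow> real) \<Rightarrow> bool" where
  "bounded_measurable M f \<longleftrightarrow> f \<in> borel_measurable M \<and> (\<exists>B. \<forall>x\<in>space M. \<bar>f x\<bar> \<le> B)"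

text \<open>The lower bound \<open>c\<close> keeps logarithms and quotients bounded.\<close>

definition pos_bounded_measurable :: "'b measure \<Rightarrow> ('b \<Rightarrow> real) \<Rightarrow> bool" where
  "pos_bounded_measurable M f \<longleftrightarrow>
     f \<in> borel_measurable M \<and> (\<exists>c>0. \<exists>C. \<forall>x\<in>space M. c \<le> f x \<and> f x \<le> C)"

text \<open>Closure rules for both predicates. The bounds hold at every point of the space, so they
  pass to sections and to integrals over one coordinate, and integrability follows structurally from
  \<open>intro bm\<close>.\<close>

named_theorems bm

lemma bounded_measurableI:
  "f \<in> borel_measurable M \<Longrightarrow> (\<And>x. x \<in> space M \<Longrightarrow> \<bar>f x\<bar> \<le> B) \<Longrightarrow> bounded_measurable M f"
  by (auto simp: bounded_measurable_def)

lemma bounded_measurable_measurable: "bounded_measurable M f \<Longrightarrow> f \<in> borel_measurable M"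
  by (simp add: bounded_measurable_def)

lemma bounded_measurable_const [bm]: "bounded_measurable M (\<lambda>_. c)"
  by (auto simp: bounded_measurable_def)

lemma bounded_measurable_add [bm]:
  assumes "bounded_measurable M f" "bounded_measurable M g"
  shows "bounded_measurable M (\<lambda>x. f x + g x)"
proof -
  from assms obtain A B where "\<And>x. x \<in> space M \<Longrightarrow> \<bar>f x\<bar> \<le> A" "\<And>x. x \<in> space M \<Longrightarrow> \<bar>g x\<bar> \<le> B"
    by (auto simp: bounded_measurable_def)
  then show ?thesis using assms
    by (intro bounded_measurableI[where B = "A + B"])
       (auto simp: bounded_measurable_def intro!: order_trans[OF abs_triangle_ineq] add_mono)
qed

lemma bounded_measurable_mult [bm]:
  assumes "bounded_measurable M f" "bounded_measurable M g"
  shows "bounded_measurable M (\<lambda>x. f x * g x)"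
proof -
  from assms obtain A B where *: "\<And>x. x \<in> space M \<Longrightarrow> \<bar>f x\<bar> \<le> A" "\<And>x. x \<in> space M \<Longrightarrow> \<bar>g x\<bar> \<le> B"
    by (auto simp: bounded_measurable_def)
  have "\<bar>f x * g x\<bar> \<le> A * B" if "x \<in> space M" for x
    unfolding abs_mult using *[OF that] by (intro mult_mono) auto
  then show ?thesis using assms
    by (intro bounded_measurableI[where B = "A * B"]) (auto simp: bounded_measurable_def)
qed

lemma bounded_measurable_uminus [bm]:
  "bounded_measurable M f \<Longrightarrow> bounded_measurable M (\<lambda>x. - f x)"
  by (auto simp: bounded_measurable_def)

lemma bounded_measurable_diff [bm]:
  "bounded_measurable M f \<Longrightarrow> bounded_measurable M g \<Longrightarrow> bounded_measurable M (\<lambda>x. f x - g x)"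
  using bounded_measurable_add[OF _ bounded_measurable_uminus, of M f g] by simp

lemma bounded_measurable_sum [bm]:
  "(\<And>i. i \<in> A \<Longrightarrow> bounded_measurable M (f i)) \<Longrightarrow> bounded_measurable M (\<lambda>x. \<Sum>i\<in>A. f i x)"
  by (induction A rule: infinite_finite_induct) (auto intro!: bm)

lemma bounded_measurable_max [bm]:
  assumes "bounded_measurable M f" "bounded_measurable M g"
  shows "bounded_measurable M (\<lambda>x. max (f x) (g x))"
proof -
  from assms obtain A B where "\<And>x. x \<in> space M \<Longrightarrow> \<bar>f x\<bar> \<le> A" "\<And>x. x \<in> space M \<Longrightarrow> \<bar>g x\<bar> \<le> B"
    by (auto simp: bounded_measurable_def)
  then show ?thesis using assms
    by (intro bounded_measurableI[where B = "max A B"])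
       (fastforce simp: bounded_measurable_def max_def)+
qed

lemma bounded_measurable_min [bm]:
  assumes "bounded_measurable M f" "bounded_measurable M g"
  shows "bounded_measurable M (\<lambda>x. min (f x) (g x))"
proof -
  have "bounded_measurable M (\<lambda>x. - max (- f x) (- g x))" using assms by (intro bm)
  moreover have "- max (- f x) (- g x) = min (f x) (g x)" for x by (simp add: min_def max_def)
  ultimately show ?thesis by simp
qed

lemma pos_bounded_measurable_exp [bm]:
  assumes "bounded_measurable M f"
  shows "pos_bounded_measurable M (\<lambda>x. exp (f x))"
proof -
  from assms obtain A where A: "\<And>x. x \<in> space M \<Longrightarrow> \<bar>f x\<bar> \<le> A"
    by (auto simp: bounded_measurable_def)
  have "exp (- A) \<le> exp (f x) \<and> exp (f x) \<le> exp A" if "x \<in> space M" for x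
    using A[OF that] by auto
  then show ?thesis using assms
    unfolding pos_bounded_measurable_def bounded_measurable_def
    by (intro conjI exI[of _ "exp (- A)"] exI[of _ "exp A"]) auto
qed

lemma bounded_measurable_pos:
  assumes "pos_bounded_measurable M f"
  shows "bounded_measurable M f"
proof -
  from assms obtain c C where "c > 0" "\<And>x. x \<in> space M \<Longrightarrow> c \<le> f x \<and> f x \<le> C"
    by (auto simp: pos_bounded_measurable_def)
  then show ?thesis using assms
    by (intro bounded_measurableI[where B = C]) (force simp: pos_bounded_measurable_def)+
qed

lemma bounded_measurable_ln [bm]:
  assumes "pos_bounded_measurable M f"
  shows "bounded_measurable M (\<lambda>x. ln (f x))"
proof -
  from assms obtain c C where *: "c > 0" "\<And>x. x \<in> space M \<Longrightarrow> c \<le> f x \<and> f x \<le> C"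
    by (auto simp: pos_bounded_measurable_def)
  have "\<bar>ln (f x)\<bar> \<le> max \<bar>ln c\<bar> \<bar>ln C\<bar>" if "x \<in> space M" for x
  proof -
    have "ln c \<le> ln (f x)" "ln (f x) \<le> ln C" using * *(2)[OF that] by auto
    then show ?thesis by linarith
  qed
  then show ?thesis using assms
    by (intro bounded_measurableI) (auto simp: pos_bounded_measurable_def)
qed

lemma pos_bounded_measurable_divide [bm]:
  assumes "pos_bounded_measurable M f" "pos_bounded_measurable M g"
  shows "pos_bounded_measurable M (\<lambda>x. f x / g x)"
proof -
  from assms obtain c C where *: "c > 0" "\<And>x. x \<in> space M \<Longrightarrow> c \<le> f x \<and> f x \<le> C"
    by (auto simp: pos_bounded_measurable_def)
  from assms obtain d D where **: "d > 0" "\<And>x. x \<in> space M \<Longrightarrow> d \<le> g x \<and> g x \<le> D"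
    by (auto simp: pos_bounded_measurable_def)
  have "c / (max D d) \<le> f x / g x \<and> f x / g x \<le> C / d" if "x \<in> space M" for x
    using *(1) **(1) *(2)[OF that] **(2)[OF that] by (auto intro!: frac_le)
  moreover have "c / max D d > 0" using * ** by auto
  ultimately show ?thesis using assms
    unfolding pos_bounded_measurable_def by (blast intro: borel_measurable_divide)
qed

lemma (in finite_measure) integrable_bounded_measurable [bm]:
  assumes "bounded_measurable M f"
  shows "integrable M f"
proof -
  from assms obtain B where "f \<in> borel_measurable M" "\<And>x. x \<in> space M \<Longrightarrow> \<bar>f x\<bar> \<le> B"
    by (auto simp: bounded_measurable_def)
  then show ?thesis by (intro integrable_const_bound[where B = B]) auto
qed

section \<open>Integrating out one coordinate of a product space\<close>

context finite_product_prob_space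
begin

text \<open>The conditional expectation given the coordinates other than \<open>k\<close>. It stays
  a function on the full product, so that all functions share one domain;
  \<open>coord_independent\<close> below expresses measurability with respect to the other
  coordinates.\<close>

definition coord_integral :: "'a \<Rightarrow> (('a \<Rightarrow> 'b) \<Rightarrow> real) \<Rightarrow> ('a \<Rightarrow> 'b) \<Rightarrow> real" where
  "coord_integral k f x = (\<integral>y. f (x(k := y)) \<partial>M k)"

abbreviation coord_independent :: "'a \<Rightarrow> (('a \<Rightarrow> 'b) \<Rightarrow> real) \<Rightarrow> bool" where
  "coord_independent k h \<equiv> (\<forall>x\<in>space (Pi\<^sub>M I M). \<forall>y\<in>space (M k). h (x(k := y)) = h x)"

lemma fun_upd_in_space:
  "k \<in> I \<Longrightarrow> x \<in> space (Pi\<^sub>M I M) \<Longrightarrow> y \<in> space (M k) \<Longrightarrow> x(k := y) \<in> space (Pi\<^sub>M I M)"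
  by (auto simp: space_PiM PiE_def extensional_def)

lemma measurable_fun_upd_pair:
  assumes "k \<in> I"
  shows "(\<lambda>(x, y). x(k := y)) \<in> Pi\<^sub>M I M \<Otimes>\<^sub>M M k \<rightarrow>\<^sub>M Pi\<^sub>M I M"
  using measurable_add_dim[of k I M] assms by (simp add: insert_absorb)

lemma measurable_section:
  assumes k: "k \<in> I" and f: "f \<in> borel_measurable (Pi\<^sub>M I M)" and x: "x \<in> space (Pi\<^sub>M I M)"
  shows "(\<lambda>y. f (x(k := y))) \<in> borel_measurable (M k)"
proof -
  have "(\<lambda>y. x(k := y)) \<in> M k \<rightarrow>\<^sub>M Pi\<^sub>M I M"
    using measurable_compose[OF measurable_Pair1'[OF x] measurable_fun_upd_pair[OF k]] by simp
  from measurable_compose[OF this f] show ?thesis .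
qed

lemma bounded_measurable_section:
  assumes k: "k \<in> I" and f: "bounded_measurable (Pi\<^sub>M I M) f" and x: "x \<in> space (Pi\<^sub>M I M)"
  shows "bounded_measurable (M k) (\<lambda>y. f (x(k := y)))"
proof -
  from f obtain B where B: "\<And>x. x \<in> space (Pi\<^sub>M I M) \<Longrightarrow> \<bar>f x\<bar> \<le> B"
    by (auto simp: bounded_measurable_def)
  show ?thesis
    by (intro bounded_measurableI[where B = B] measurable_section[OF k _ x] B fun_upd_in_space k x)
       (use f in \<open>auto simp: bounded_measurable_def\<close>)
qed

lemma integrable_section:
  assumes "k \<in> I" "bounded_measurable (Pi\<^sub>M I M) f" "x \<in> space (Pi\<^sub>M I M)"
  shows "integrable (M k) (\<lambda>y. f (x(k := y)))"
  by (intro M.integrable_bounded_measurable bounded_measurable_section assms)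

lemma borel_measurable_coord_integral:
  assumes k: "k \<in> I" and f: "f \<in> borel_measurable (Pi\<^sub>M I M)"
  shows "coord_integral k f \<in> borel_measurable (Pi\<^sub>M I M)"
proof -
  have "(\<lambda>(x, y). f (x(k := y))) \<in> borel_measurable (Pi\<^sub>M I M \<Otimes>\<^sub>M M k)"
    using measurable_compose[OF measurable_fun_upd_pair[OF k] f] by (simp add: case_prod_beta')
  then show ?thesis
    unfolding coord_integral_def by (rule M.borel_measurable_lebesgue_integral)
qed

lemma coord_integral_mono:
  assumes "k \<in> I" "bounded_measurable (Pi\<^sub>M I M) f" "bounded_measurable (Pi\<^sub>M I M) g"
    and "x \<in> space (Pi\<^sub>M I M)" "\<And>x. x \<in> space (Pi\<^sub>M I M) \<Longrightarrow> f x \<le> g x"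
  shows "coord_integral k f x \<le> coord_integral k g x"
  unfolding coord_integral_def
  by (intro integral_mono integrable_section assms fun_upd_in_space)

lemma coord_integral_const [simp]: "coord_integral k (\<lambda>_. c) x = c"
  by (simp add: coord_integral_def M.prob_space)

lemma bounded_measurable_coord_integral [bm]:
  assumes k: "k \<in> I" and f: "bounded_measurable (Pi\<^sub>M I M) f"
  shows "bounded_measurable (Pi\<^sub>M I M) (coord_integral k f)"
proof -
  from f obtain B where B: "\<And>x. x \<in> space (Pi\<^sub>M I M) \<Longrightarrow> \<bar>f x\<bar> \<le> B"
    by (auto simp: bounded_measurable_def)
  have "coord_integral k f x \<le> B \<and> - B \<le> coord_integral k f x" if x: "x \<in> space (Pi\<^sub>M I M)" for x
    using coord_integral_mono[OF k f bounded_measurable_const[of _ B] x]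
      coord_integral_mono[OF k bounded_measurable_const[of _ "- B"] f x] B
    by (force simp: abs_le_iff)
  then show ?thesis
    using f k by (intro bounded_measurableI[where B = B] borel_measurable_coord_integral)
      (auto simp: bounded_measurable_def abs_le_iff minus_le_iff)
qed

lemma pos_bounded_measurable_coord_integral [bm]:
  assumes k: "k \<in> I" and f: "pos_bounded_measurable (Pi\<^sub>M I M) f"
  shows "pos_bounded_measurable (Pi\<^sub>M I M) (coord_integral k f)"
proof -
  from f obtain c C where c: "c > 0" "\<And>x. x \<in> space (Pi\<^sub>M I M) \<Longrightarrow> c \<le> f x \<and> f x \<le> C"
    by (auto simp: pos_bounded_measurable_def)
  note f' = bounded_measurable_pos[OF f]
  have "c \<le> coord_integral k f x \<and> coord_integral k f x \<le> C" if x: "x \<in> space (Pi\<^sub>M I M)" for x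
    using coord_integral_mono[OF k f' bounded_measurable_const[of _ C] x]
      coord_integral_mono[OF k bounded_measurable_const[of _ c] f' x] c
    by force
  with c(1) show ?thesis
    using f k borel_measurable_coord_integral unfolding pos_bounded_measurable_def by blast
qed

lemma coord_integral_mult_left:
  assumes k: "k \<in> I" and x: "x \<in> space (Pi\<^sub>M I M)" and h: "coord_independent k h"
  shows "coord_integral k (\<lambda>x. h x * f x) x = h x * coord_integral k f x"
proof -
  have "coord_integral k (\<lambda>x. h x * f x) x = (\<integral>y. h x * f (x(k := y)) \<partial>M k)"
    unfolding coord_integral_def using h x by (intro Bochner_Integration.integral_cong) auto
  then show ?thesis by (simp add: coord_integral_def)
qed

lemma coord_independent_coord_integral [simp]: "coord_independent k (coord_integral k f)"
  by (simp add: coord_integral_def)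

lemma coord_independent_other:
  assumes k: "k \<in> I" and j: "j \<noteq> k" and h: "coord_independent j h"
  shows "coord_independent j (coord_integral k h)"
proof (intro ballI)
  fix x y assume x: "x \<in> space (Pi\<^sub>M I M)" and y: "y \<in> space (M j)"
  show "coord_integral k h (x(j := y)) = coord_integral k h x"
    unfolding coord_integral_def
  proof (intro Bochner_Integration.integral_cong refl)
    fix z assume z: "z \<in> space (M k)"
    have "x(j := y, k := z) = x(k := z, j := y)" using j by (simp add: fun_upd_twist)
    then show "h (x(j := y, k := z)) = h (x(k := z))"
      using h fun_upd_in_space[OF k x z] y by simp
  qed
qed

text \<open>The tower property: once coordinate \<open>k\<close> is split off, the inner integral of
  \<open>coord_integral k f\<close> is that of a constant.\<close>

lemma integral_coord_integral:
  assumes k: "k \<in> I" and f: "bounded_measurable (Pi\<^sub>M I M) f"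
  shows "(\<integral>x. coord_integral k f x \<partial>Pi\<^sub>M I M) = (\<integral>x. f x \<partial>Pi\<^sub>M I M)"
proof -
  define J where "J = I - {k}"
  have J: "finite J" "k \<notin> J" "insert k J = I"
    using k finite_index by (auto simp: J_def)
  have "integrable (Pi\<^sub>M (insert k J) M) f" "integrable (Pi\<^sub>M (insert k J) M) (coord_integral k f)"
    unfolding J(3) by (intro bm f k)+
  note insert = this[THEN product_integral_insert[OF J(1,2)], unfolded J(3)]
  have "(\<integral>x. coord_integral k f x \<partial>Pi\<^sub>M I M) = (\<integral>x. (\<integral>y. coord_integral k f (x(k := y)) \<partial>M k) \<partial>Pi\<^sub>M J M)"
    by (rule insert(2))
  also have "\<dots> = (\<integral>x. (\<integral>y. f (x(k := y)) \<partial>M k) \<partial>Pi\<^sub>M J M)"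
    by (simp add: coord_integral_def M.prob_space)
  also have "\<dots> = (\<integral>x. f x \<partial>Pi\<^sub>M I M)"
    by (rule insert(1)[symmetric])
  finally show ?thesis .
qed

lemma integral_coord_integral_mult:
  assumes k: "k \<in> I" and h: "bounded_measurable (Pi\<^sub>M I M) h" "coord_independent k h"
    and f: "bounded_measurable (Pi\<^sub>M I M) f"
  shows "(\<integral>x. h x * coord_integral k f x \<partial>Pi\<^sub>M I M) = (\<integral>x. h x * f x \<partial>Pi\<^sub>M I M)"
proof -
  have "(\<integral>x. h x * coord_integral k f x \<partial>Pi\<^sub>M I M) = (\<integral>x. coord_integral k (\<lambda>x. h x * f x) x \<partial>Pi\<^sub>M I M)"
    by (intro Bochner_Integration.integral_cong refl coord_integral_mult_left[symmetric] k h)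
  also have "\<dots> = (\<integral>x. h x * f x \<partial>Pi\<^sub>M I M)"
    by (intro integral_coord_integral k bm h f)
  finally show ?thesis .
qed

section \<open>Entropy duality and tensorization\<close>

lemma pos_bounded_measurable_pos:
  "pos_bounded_measurable N f \<Longrightarrow> x \<in> space N \<Longrightarrow> 0 < f x"
  by (force simp: pos_bounded_measurable_def)

text \<open>\<open>h / coord_integral k h\<close> is a conditional density given the other
  coordinates, hence has conditional mean 1.\<close>

lemma integral_mult_ratio:
  assumes k: "k \<in> I" and g: "bounded_measurable (Pi\<^sub>M I M) g" "coord_independent k g"
    and h: "pos_bounded_measurable (Pi\<^sub>M I M) h"
  shows "(\<integral>x. g x * (h x / coord_integral k h x) \<partial>Pi\<^sub>M I M) = (\<integral>x. g x \<partial>Pi\<^sub>M I M)"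
proof -
  note Eh = pos_bounded_measurable_coord_integral[OF k h]
  have one: "pos_bounded_measurable (Pi\<^sub>M I M) (\<lambda>_. 1)"
    unfolding pos_bounded_measurable_def by (intro conjI exI[of _ 1]) auto
  have "(\<integral>x. g x * (h x / coord_integral k h x) \<partial>Pi\<^sub>M I M) =
        (\<integral>x. (g x * (1 / coord_integral k h x)) * h x \<partial>Pi\<^sub>M I M)"
    by simp
  also have "\<dots> = (\<integral>x. (g x * (1 / coord_integral k h x)) * coord_integral k h x \<partial>Pi\<^sub>M I M)"
    by (intro integral_coord_integral_mult[symmetric] k bm g bounded_measurable_pos h
        bounded_measurable_pos[OF pos_bounded_measurable_divide] one)
       (use g in \<open>auto simp: coord_integral_def\<close>)
  also have "\<dots> = (\<integral>x. g x \<partial>Pi\<^sub>M I M)"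
    by (intro Bochner_Integration.integral_cong refl)
       (use pos_bounded_measurable_pos[OF Eh] in force)
  finally show ?thesis .
qed

text \<open>The variational formula for conditional entropy: \<open>h = f\<close> is optimal.
  \<open>young_exp\<close> is applied with \<open>A = f\<close> and
  \<open>B = coord_integral k f\<close>; its two correction terms have equal integrals, because
  \<open>h / coord_integral k h\<close> has conditional mean 1.\<close>

lemma entropy_coordinate_bound:
  assumes k: "k \<in> I" and f: "pos_bounded_measurable (Pi\<^sub>M I M) f"
    and h: "pos_bounded_measurable (Pi\<^sub>M I M) h"
  shows "(\<integral>x. f x * ln (h x / coord_integral k h x) \<partial>Pi\<^sub>M I M) \<le>
         (\<integral>x. f x * ln (f x / coord_integral k f x) \<partial>Pi\<^sub>M I M)"
proof -
  note Ef = pos_bounded_measurable_coord_integral[OF k f]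
  note Eh = pos_bounded_measurable_coord_integral[OF k h]
  note bnds = f h Ef Eh bounded_measurable_pos[OF f] bounded_measurable_pos[OF Ef]
    bounded_measurable_pos[OF pos_bounded_measurable_divide[OF h Eh]]
  have "(\<integral>x. f x * ln (h x / coord_integral k h x) \<partial>Pi\<^sub>M I M) \<le>
     (\<integral>x. (f x * ln (f x / coord_integral k f x) - f x) + coord_integral k f x * (h x / coord_integral k h x) \<partial>Pi\<^sub>M I M)"
  proof (rule integral_mono)
    fix x assume x: "x \<in> space (Pi\<^sub>M I M)"
    note pos = pos_bounded_measurable_pos[OF f x] pos_bounded_measurable_pos[OF h x]
      pos_bounded_measurable_pos[OF Ef x] pos_bounded_measurable_pos[OF Eh x]
    show "f x * ln (h x / coord_integral k h x) \<le>
       f x * ln (f x / coord_integral k f x) - f x + coord_integral k f x * (h x / coord_integral k h x)"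
      using young_exp[OF pos(1) pos(3), of "ln (h x / coord_integral k h x)"] pos by simp
  qed (intro bm bnds)+
  also have "\<dots> = (\<integral>x. f x * ln (f x / coord_integral k f x) \<partial>Pi\<^sub>M I M) - (\<integral>x. f x \<partial>Pi\<^sub>M I M)
      + (\<integral>x. coord_integral k f x * (h x / coord_integral k h x) \<partial>Pi\<^sub>M I M)"
    by (subst Bochner_Integration.integral_add Bochner_Integration.integral_diff; (intro bm bnds)?)+ simp
  also have "(\<integral>x. coord_integral k f x * (h x / coord_integral k h x) \<partial>Pi\<^sub>M I M) = (\<integral>x. f x \<partial>Pi\<^sub>M I M)"
    by (simp only: integral_mult_ratio[OF k bnds(6) coord_independent_coord_integral h]
        integral_coord_integral[OF k bnds(5)])
  finally show ?thesis by simp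
qed

text \<open>
  Integrating out the coordinates one by one writes \<open>ln (f / \<integral>f)\<close> as a telescoping sum.
\<close>

lemma entropy_telescope:
  assumes f: "pos_bounded_measurable (Pi\<^sub>M I M) f" and J: "J \<subseteq> I"
  shows "\<exists>h. pos_bounded_measurable (Pi\<^sub>M I M) h \<and> (\<forall>k\<in>J. coord_independent k h) \<and>
           (\<integral>x. h x \<partial>Pi\<^sub>M I M) = (\<integral>x. f x \<partial>Pi\<^sub>M I M) \<and>
           (\<integral>x. f x * ln (f x / h x) \<partial>Pi\<^sub>M I M) \<le>
             (\<Sum>k\<in>J. \<integral>x. f x * ln (f x / coord_integral k f x) \<partial>Pi\<^sub>M I M)"
  using finite_subset[OF J finite_index] J
proof (induction J rule: finite_induct)
  case empty
  have "(\<integral>x. f x * ln (f x / f x) \<partial>Pi\<^sub>M I M) = (\<integral>x. 0 \<partial>Pi\<^sub>M I M)"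
    using pos_bounded_measurable_pos[OF f] by (intro Bochner_Integration.integral_cong) force+
  then show ?case
    by (intro exI[of _ f]) (use f in auto)
next
  case (insert k J)
  then have k: "k \<in> I" by simp
  from insert have "J \<subseteq> I" by simp
  from insert.IH[OF this] obtain h where h: "pos_bounded_measurable (Pi\<^sub>M I M) h" "\<forall>k\<in>J. coord_independent k h"
     "(\<integral>x. h x \<partial>Pi\<^sub>M I M) = (\<integral>x. f x \<partial>Pi\<^sub>M I M)"
     and le: "(\<integral>x. f x * ln (f x / h x) \<partial>Pi\<^sub>M I M) \<le>
             (\<Sum>k\<in>J. \<integral>x. f x * ln (f x / coord_integral k f x) \<partial>Pi\<^sub>M I M)"
    by blast
  note Eh = pos_bounded_measurable_coord_integral[OF k h(1)]
  have "(\<integral>x. f x * ln (f x / coord_integral k h x) \<partial>Pi\<^sub>M I M) =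
        (\<integral>x. f x * ln (f x / h x) + f x * ln (h x / coord_integral k h x) \<partial>Pi\<^sub>M I M)"
  proof (intro Bochner_Integration.integral_cong refl)
    fix x assume x: "x \<in> space (Pi\<^sub>M I M)"
    show "f x * ln (f x / coord_integral k h x) =
      f x * ln (f x / h x) + f x * ln (h x / coord_integral k h x)"
      using pos_bounded_measurable_pos[OF f x] pos_bounded_measurable_pos[OF h(1) x]
        pos_bounded_measurable_pos[OF Eh x] by (simp add: ln_div algebra_simps)
  qed
  also have "\<dots> = (\<integral>x. f x * ln (f x / h x) \<partial>Pi\<^sub>M I M) + (\<integral>x. f x * ln (h x / coord_integral k h x) \<partial>Pi\<^sub>M I M)"
    by (intro Bochner_Integration.integral_add bm f h(1) Eh bounded_measurable_pos[OF f])
  also have "\<dots> \<le> (\<Sum>k\<in>insert k J. \<integral>x. f x * ln (f x / coord_integral k f x) \<partial>Pi\<^sub>M I M)"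
    using insert.hyps le entropy_coordinate_bound[OF k f h(1)] by simp
  finally have *: "(\<integral>x. f x * ln (f x / coord_integral k h x) \<partial>Pi\<^sub>M I M) \<le> \<dots>" .
  have "coord_independent j (coord_integral k h)" if "j \<in> insert k J" for j
    using that h(2) coord_independent_other[OF k, of j h] insert.hyps(2)
    by (cases "j = k") (auto simp del: fun_upd_apply)
  moreover have "(\<integral>x. coord_integral k h x \<partial>Pi\<^sub>M I M) = (\<integral>x. f x \<partial>Pi\<^sub>M I M)"
    using integral_coord_integral[OF k bounded_measurable_pos[OF h(1)]] h(3) by simp
  ultimately show ?case using * Eh by blast
qed

text \<open>The coordinates of \<open>x\<close> are replaced by those of \<open>y\<close> one at a
  time.\<close>

lemma coord_independent_all_const:
  assumes h: "\<forall>k\<in>I. coord_independent k h"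
    and x: "x \<in> space (Pi\<^sub>M I M)" and y: "y \<in> space (Pi\<^sub>M I M)"
  shows "h x = h y"
proof -
  have "h (\<lambda>i. if i \<in> J then y i else x i) = h x \<and> (\<lambda>i. if i \<in> J then y i else x i) \<in> space (Pi\<^sub>M I M)"
    if J: "J \<subseteq> I" for J
    using finite_subset[OF J finite_index] J
  proof (induction J rule: finite_induct)
    case empty
    then show ?case using x by simp
  next
    case (insert k J)
    have eq: "(\<lambda>i. if i \<in> insert k J then y i else x i) = (\<lambda>i. if i \<in> J then y i else x i)(k := y k)"
      by auto
    have "y k \<in> space (M k)" using y insert.prems by (auto simp: space_PiM)
    then show ?case unfolding eq using insert h fun_upd_in_space by simp
  qed
  from this[of I] have "h (\<lambda>i. if i \<in> I then y i else x i) = h x" by simp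
  moreover have "(\<lambda>i. if i \<in> I then y i else x i) = y"
    using x y by (auto simp: space_PiM PiE_def extensional_def)
  ultimately show ?thesis by simp
qed

text \<open>Once every coordinate is integrated out, \<open>h\<close> in
  \<open>entropy_telescope\<close> is the constant integral of \<open>f\<close>.\<close>

lemma entropy_tensorization:
  assumes f: "pos_bounded_measurable (Pi\<^sub>M I M) f"
  shows "(\<integral>x. f x * ln (f x) \<partial>Pi\<^sub>M I M) - (\<integral>x. f x \<partial>Pi\<^sub>M I M) * ln (\<integral>x. f x \<partial>Pi\<^sub>M I M) \<le>
         (\<Sum>k\<in>I. \<integral>x. f x * ln (f x / coord_integral k f x) \<partial>Pi\<^sub>M I M)"
proof -
  obtain h where h: "pos_bounded_measurable (Pi\<^sub>M I M) h" "\<forall>k\<in>I. coord_independent k h"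
     "(\<integral>x. h x \<partial>Pi\<^sub>M I M) = (\<integral>x. f x \<partial>Pi\<^sub>M I M)"
     and le: "(\<integral>x. f x * ln (f x / h x) \<partial>Pi\<^sub>M I M) \<le>
             (\<Sum>k\<in>I. \<integral>x. f x * ln (f x / coord_integral k f x) \<partial>Pi\<^sub>M I M)"
    using entropy_telescope[OF f order_refl] by auto
  obtain x0 where x0: "x0 \<in> space (Pi\<^sub>M I M)" using not_empty by blast
  have "(\<integral>x. h x \<partial>Pi\<^sub>M I M) = (\<integral>x. h x0 \<partial>Pi\<^sub>M I M)"
    by (intro Bochner_Integration.integral_cong refl coord_independent_all_const h(2) x0)
  then have h0: "h x0 = (\<integral>x. f x \<partial>Pi\<^sub>M I M)" using h(3) by (simp add: P.prob_space)
  have "(\<integral>x. f x * ln (f x / h x) \<partial>Pi\<^sub>M I M) = (\<integral>x. f x * ln (f x) - f x * ln (h x0) \<partial>Pi\<^sub>M I M)"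
  proof (intro Bochner_Integration.integral_cong refl)
    fix x assume x: "x \<in> space (Pi\<^sub>M I M)"
    show "f x * ln (f x / h x) = f x * ln (f x) - f x * ln (h x0)"
      using pos_bounded_measurable_pos[OF f x] pos_bounded_measurable_pos[OF h(1) x]
        coord_independent_all_const[OF h(2) x x0] by (simp add: ln_div algebra_simps)
  qed
  also have "\<dots> = (\<integral>x. f x * ln (f x) \<partial>Pi\<^sub>M I M) - (\<integral>x. f x * ln (h x0) \<partial>Pi\<^sub>M I M)"
    by (intro Bochner_Integration.integral_diff bm f bounded_measurable_pos[OF f])
  finally show ?thesis using le by (simp add: h0)
qed

end

section \<open>Finite centered classes\<close>

text \<open>Finiteness ensures that the supremum is attained, on which the one-coordinate estimate
  rests; countable classes are reached by a limit.\<close>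

locale finite_centered_class = finite_product_prob_space M I
  for M :: "'i \<Rightarrow> 'a measure" and I +
  fixes S :: "('i \<Rightarrow> 'a \<Rightarrow> real) set"
  assumes finite_S: "finite S" and S_ne: "S \<noteq> {}"
    and measurable_S: "\<And>s k. s \<in> S \<Longrightarrow> k \<in> I \<Longrightarrow> s k \<in> borel_measurable (M k)"
    and bounded_S: "\<And>s k y. s \<in> S \<Longrightarrow> k \<in> I \<Longrightarrow> \<bar>s k y\<bar> \<le> 1"
    and centered_S: "\<And>s k. s \<in> S \<Longrightarrow> k \<in> I \<Longrightarrow> (\<integral>y. s k y \<partial>M k) = 0"
begin

section \<open>Maximisers of a finite class\<close>

abbreviation P where "P \<equiv> Pi\<^sub>M I M"

definition comp_sum :: "('i \<Rightarrow> 'a \<Rightarrow> real) \<Rightarrow> ('i \<Rightarrow> 'a) \<Rightarrow> real" where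
  "comp_sum s x = (\<Sum>k\<in>I. s k (x k))"

definition max_sum :: "('i \<Rightarrow> 'a) \<Rightarrow> real" where
  "max_sum x = Max ((\<lambda>s. comp_sum s x) ` S)"

text \<open>The second moment is the variance, the components being centered.\<close>

definition comp_var :: "('i \<Rightarrow> 'a \<Rightarrow> real) \<Rightarrow> 'i \<Rightarrow> real" where
  "comp_var s k = (\<integral>y. (s k y)\<^sup>2 \<partial>M k)"

definition maximizers :: "('i \<Rightarrow> 'a) \<Rightarrow> ('i \<Rightarrow> 'a \<Rightarrow> real) set" where
  "maximizers x = {s \<in> S. comp_sum s x = max_sum x}"

text \<open>
  The uniform distribution on the maximisers of \<open>comp_sum s x\<close> replaces the choice of one maximiser.
\<close>

definition max_weight :: "('i \<Rightarrow> 'a \<Rightarrow> real) \<Rightarrow> ('i \<Rightarrow> 'a) \<Rightarrow> real" where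
  "max_weight s x = of_bool (s \<in> maximizers x) / real (card (maximizers x))"

lemma comp_sum_le_max_sum: "s \<in> S \<Longrightarrow> comp_sum s x \<le> max_sum x"
  unfolding max_sum_def using finite_S by (intro Max_ge) auto

lemma maximizers_subset: "maximizers x \<subseteq> S" and finite_maximizers: "finite (maximizers x)"
  using finite_S by (auto simp: maximizers_def)

lemma maximizers_ne: "maximizers x \<noteq> {}"
proof -
  have "max_sum x \<in> (\<lambda>s. comp_sum s x) ` S" unfolding max_sum_def using finite_S S_ne by (intro Max_in) auto
  then show ?thesis by (auto simp: maximizers_def)
qed

lemma card_maximizers_pos: "0 < card (maximizers x)"
  using maximizers_ne finite_maximizers by (simp add: card_gt_0_iff)

lemma max_weight_nonneg: "0 \<le> max_weight s x"
  by (simp add: max_weight_def)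

lemma max_weight_le_1: "max_weight s x \<le> 1"
  using card_maximizers_pos[of x] by (simp add: max_weight_def)

lemma sum_max_weight: "(\<Sum>s\<in>S. max_weight s x) = 1"
proof -
  have "(\<Sum>s\<in>S. max_weight s x) = (\<Sum>s\<in>S. of_bool (s \<in> maximizers x)) / real (card (maximizers x))"
    by (simp add: max_weight_def sum_divide_distrib)
  also have "(\<Sum>s\<in>S. of_bool (s \<in> maximizers x) :: real) = real (card (maximizers x))"
    using finite_S maximizers_subset[of x] by (simp add: Int_absorb1 flip: Int_def)
  finally show ?thesis using card_maximizers_pos[of x] by simp
qed

lemma max_weight_pos_imp: "max_weight s x \<noteq> 0 \<Longrightarrow> comp_sum s x = max_sum x"
  by (auto simp: max_weight_def maximizers_def)

lemma component_bm [bm]: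
  assumes "s \<in> S" "k \<in> I"
  shows "bounded_measurable P (\<lambda>x. s k (x k))"
proof -
  note measurable_S[OF assms, measurable]
  show ?thesis
    using assms bounded_S by (intro bounded_measurableI[where B = 1]) auto
qed

lemma component_bm': "s \<in> S \<Longrightarrow> k \<in> I \<Longrightarrow> bounded_measurable (M k) (s k)"
  using bounded_S measurable_S by (intro bounded_measurableI[where B = 1]) auto

lemma comp_sum_bm [bm]: "s \<in> S \<Longrightarrow> bounded_measurable P (comp_sum s)"
  unfolding comp_sum_def by (intro bm)

lemma max_sum_bm [bm]: "bounded_measurable P max_sum"
proof -
  have "bounded_measurable P (\<lambda>x. Max ((\<lambda>s. comp_sum s x) ` A))" if "finite A" "A \<noteq> {}" "A \<subseteq> S" for A
    using that
  proof (induction A rule: finite_ne_induct)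
    case (insert s A)
    have "(\<lambda>x. Max ((\<lambda>s. comp_sum s x) ` insert s A)) = (\<lambda>x. max (comp_sum s x) (Max ((\<lambda>s. comp_sum s x) ` A)))"
      using insert by (simp add: Max_insert)
    then show ?case using insert by (auto intro!: bm)
  qed (auto intro!: bm simp: comp_sum_bm[unfolded eta_contract_eq])
  from this[OF finite_S S_ne] show ?thesis by (simp add: max_sum_def[abs_def])
qed

lemma max_weight_bm [bm]:
  assumes "s \<in> S"
  shows "bounded_measurable P (max_weight s)"
proof -
  note [measurable] = bounded_measurable_measurable[OF comp_sum_bm] bounded_measurable_measurable[OF max_sum_bm]
  have "(\<lambda>x. \<Sum>s\<in>S. if comp_sum s x = max_sum x then 1 else 0 :: real) \<in> borel_measurable P"
    by measurable
  moreover have "(\<Sum>s\<in>S. if comp_sum s x = max_sum x then 1 else 0) = real (card (maximizers x))" for x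
    using finite_S by (simp add: maximizers_def sum.If_cases Int_def)
  ultimately have [measurable]: "(\<lambda>x. real (card (maximizers x))) \<in> borel_measurable P"
    by simp
  have "max_weight s = (\<lambda>x. (if comp_sum s x = max_sum x then 1 else 0) / real (card (maximizers x)))"
    using assms by (auto simp: max_weight_def maximizers_def fun_eq_iff)
  also have "\<dots> \<in> borel_measurable P"
    using assms by measurable
  finally show ?thesis
    using max_weight_nonneg max_weight_le_1 by (intro bounded_measurableI[where B = 1]) auto
qed

lemma comp_sum_fun_upd:
  assumes "k \<in> I"
  shows "comp_sum s (x(k := y)) = comp_sum s x - s k (x k) + s k y"
proof -
  have "comp_sum s z = s k (z k) + (\<Sum>j\<in>I-{k}. s j (z j))" for z
    unfolding comp_sum_def using assms finite_index by (simp add: sum.remove)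
  from this[of x] this[of "x(k := y)"] show ?thesis by simp
qed

lemma comp_var_bounds: "s \<in> S \<Longrightarrow> k \<in> I \<Longrightarrow> 0 \<le> comp_var s k \<and> comp_var s k \<le> 1"
proof (intro conjI)
  assume s: "s \<in> S" "k \<in> I"
  show "0 \<le> comp_var s k" by (simp add: comp_var_def)
  have "comp_var s k \<le> (\<integral>y. 1 \<partial>M k)" unfolding comp_var_def
    using bounded_S[OF s] abs_square_le_1 unfolding power2_eq_square
    by (intro integral_mono M.integrable_bounded_measurable bm component_bm' s)
      (simp add: power2_eq_square[symmetric] abs_square_le_1)
  then show "comp_var s k \<le> 1" by (simp add: M.prob_space)
qed

section \<open>First and second moments under the product measure\<close>

lemma integral_coordinate_mult:
  assumes k: "k \<in> I" and h: "bounded_measurable P h" "coord_independent k h"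
    and \<phi>: "bounded_measurable (M k) \<phi>"
  shows "(\<integral>x. h x * \<phi> (x k) \<partial>P) = (\<integral>y. \<phi> y \<partial>M k) * (\<integral>x. h x \<partial>P)"
proof -
  have "bounded_measurable P (\<lambda>x. \<phi> (x k))"
  proof -
    from \<phi> obtain B where B: "\<And>y. y \<in> space (M k) \<Longrightarrow> \<bar>\<phi> y\<bar> \<le> B"
      by (auto simp: bounded_measurable_def)
    note [measurable] = bounded_measurable_measurable[OF \<phi>]
    show ?thesis using k B by (intro bounded_measurableI[where B = B]) (auto simp: space_PiM)
  qed
  from integral_coord_integral_mult[OF k h this]
  have "(\<integral>x. h x * \<phi> (x k) \<partial>P) = (\<integral>x. h x * coord_integral k (\<lambda>x. \<phi> (x k)) x \<partial>P)" by simp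
  also have "coord_integral k (\<lambda>x. \<phi> (x k)) = (\<lambda>_. \<integral>y. \<phi> y \<partial>M k)"
    by (simp add: coord_integral_def fun_eq_iff)
  finally show ?thesis by (simp add: mult.commute)
qed

lemma integral_component: "s \<in> S \<Longrightarrow> k \<in> I \<Longrightarrow> (\<integral>x. s k (x k) \<partial>P) = 0"
  using integral_coordinate_mult[of k "\<lambda>_. 1" "s k"] by (simp add: bm component_bm' centered_S)

lemma integral_comp_sum: "s \<in> S \<Longrightarrow> (\<integral>x. comp_sum s x \<partial>P) = 0"
  unfolding comp_sum_def by (subst Bochner_Integration.integral_sum) (auto intro!: bm simp: integral_component)

lemma integral_max_sum_nonneg: "0 \<le> (\<integral>x. max_sum x \<partial>P)"
proof -
  obtain s where s: "s \<in> S" using S_ne by blast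
  have "(\<integral>x. comp_sum s x \<partial>P) \<le> (\<integral>x. max_sum x \<partial>P)"
    by (intro integral_mono comp_sum_le_max_sum s) (use s in \<open>auto intro!: bm\<close>)
  then show ?thesis using integral_comp_sum[OF s] by simp
qed

text \<open>Variances add: the cross terms vanish by independence and centering.\<close>

lemma integral_comp_sum_square:
  assumes s: "s \<in> S"
  shows "(\<integral>x. (comp_sum s x)\<^sup>2 \<partial>P) = (\<Sum>k\<in>I. comp_var s k)"
proof -
  have cross: "(\<integral>x. s j (x j) * s k (x k) \<partial>P) = (if j = k then comp_var s k else 0)"
    if "j \<in> I" "k \<in> I" for j k
  proof (cases "j = k")
    case True
    have "bounded_measurable (M k) (\<lambda>y. s k y * s k y)"
      by (intro bm component_bm' s that)
    from integral_coordinate_mult[OF that(2) _ _ this, of "\<lambda>_. 1"] show ?thesis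
      using True by (simp add: bm comp_var_def power2_eq_square P.prob_space)
  next
    case False
    then show ?thesis
      using integral_coordinate_mult[OF that(2) component_bm[OF s that(1)] _ component_bm'[OF s that(2)]]
      by (simp add: centered_S[OF s that(2)])
  qed
  have "(\<integral>x. (comp_sum s x)\<^sup>2 \<partial>P) = (\<integral>x. (\<Sum>j\<in>I. \<Sum>k\<in>I. s j (x j) * s k (x k)) \<partial>P)"
    by (simp add: comp_sum_def power2_eq_square sum_product)
  also have "\<dots> = (\<Sum>j\<in>I. \<Sum>k\<in>I. \<integral>x. s j (x j) * s k (x k) \<partial>P)"
    by (simp only: Bochner_Integration.integral_sum bm s cong: sum.cong)
  also have "\<dots> = (\<Sum>j\<in>I. \<Sum>k\<in>I. if j = k then comp_var s k else 0)"
    by (intro sum.cong refl cross)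
  also have "\<dots> = (\<Sum>k\<in>I. comp_var s k)"
    using finite_index by simp
  finally show ?thesis .
qed

section \<open>Entropy contributed by one coordinate\<close>

context
  fixes t :: real and k :: 'i
begin

definition \<alpha> :: real where "\<alpha> = t * exp t / (1 + t * exp t)"

definition tilt :: "('i \<Rightarrow> 'a) \<Rightarrow> real" where
  "tilt x = exp (t * max_sum x)"

definition incr :: "('i \<Rightarrow> 'a \<Rightarrow> real) \<Rightarrow> ('i \<Rightarrow> 'a) \<Rightarrow> real" where
  "incr s x = t * s k (x k)"

text \<open>The factor of \<open>exp (t * comp_sum s x)\<close> that does not involve
  \<open>x k\<close>.\<close>

definition frozen :: "('i \<Rightarrow> 'a \<Rightarrow> real) \<Rightarrow> ('i \<Rightarrow> 'a) \<Rightarrow> real" where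
  "frozen s x = exp (t * (comp_sum s x - s k (x k)))"

text \<open>The conditional probability, given the other coordinates, that a uniformly chosen
  maximiser equals \<open>s\<close>.\<close>

definition mean_weight :: "('i \<Rightarrow> 'a \<Rightarrow> real) \<Rightarrow> ('i \<Rightarrow> 'a) \<Rightarrow> real" where
  "mean_weight s = coord_integral k (max_weight s)"

definition \<rho> :: "('i \<Rightarrow> 'a \<Rightarrow> real) \<Rightarrow> ('i \<Rightarrow> 'a) \<Rightarrow> real" where
  "\<rho> s x = exp (min (incr s x) \<alpha>)"

text \<open>The function \<open>q\<close> of the overview; its exponential is a conditional
  density.\<close>

definition log_ratio :: "('i \<Rightarrow> 'a) \<Rightarrow> real" where
  "log_ratio x = ln (tilt x / coord_integral k tilt x)"

definition small_variance :: "('i \<Rightarrow> 'a \<Rightarrow> real) set" where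
  "small_variance = {s \<in> S. t\<^sup>2 * comp_var s k / 2 \<le> \<alpha>}"

text \<open>
  Functions of large variance are left out because duality gives nothing useful for them.
\<close>

definition minorant :: "('i \<Rightarrow> 'a) \<Rightarrow> real" where
  "minorant x = (\<Sum>s\<in>small_variance. mean_weight s x * frozen s x * \<rho> s x)"

context
  assumes t: "0 < t" and k: "k \<in> I"
begin

lemma \<alpha>: "0 < \<alpha>" "\<alpha> * (1 + t * exp t) = t * exp t"
proof -
  have "0 < t * exp t" using t by simp
  then show "0 < \<alpha>" "\<alpha> * (1 + t * exp t) = t * exp t" by (auto simp: \<alpha>_def field_simps)
qed

lemma small_variance: "small_variance \<subseteq> S" "finite small_variance"
  using finite_S by (auto simp: small_variance_def)

lemma incr_bm [bm]: "s \<in> S \<Longrightarrow> bounded_measurable P (incr s)"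
  unfolding incr_def by (intro bm k)

lemma tilt_pbm: "pos_bounded_measurable P tilt"
  unfolding tilt_def by (intro bm)

lemma frozen_pbm: "s \<in> S \<Longrightarrow> pos_bounded_measurable P (frozen s)"
  unfolding frozen_def by (intro bm k)

lemma mean_weight_bm [bm]: "s \<in> S \<Longrightarrow> bounded_measurable P (mean_weight s)"
  unfolding mean_weight_def by (intro bm k)

lemma \<rho>_pbm: "s \<in> S \<Longrightarrow> pos_bounded_measurable P (\<rho> s)"
  unfolding \<rho>_def by (intro bm)

lemma log_ratio_bm [bm]: "bounded_measurable P log_ratio"
  unfolding log_ratio_def by (intro bm k tilt_pbm)

lemmas [bm] = tilt_pbm[THEN bounded_measurable_pos] frozen_pbm[THEN bounded_measurable_pos] \<rho>_pbm[THEN bounded_measurable_pos]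

lemma minorant_bm [bm]: "bounded_measurable P minorant"
  unfolding minorant_def using small_variance by (intro bm) auto

lemma mean_weight_nonneg: "0 \<le> mean_weight s x"
  unfolding mean_weight_def coord_integral_def by (simp add: max_weight_nonneg)

lemma sum_mean_weight:
  assumes x: "x \<in> space P"
  shows "(\<Sum>s\<in>S. mean_weight s x) = 1"
proof -
  have "(\<Sum>s\<in>S. mean_weight s x) = coord_integral k (\<lambda>x. \<Sum>s\<in>S. max_weight s x) x"
    unfolding mean_weight_def coord_integral_def
    by (subst Bochner_Integration.integral_sum) (auto intro!: integrable_section[OF k _ x] max_weight_bm)
  then show ?thesis by (simp add: sum_max_weight)
qed

lemma frozen_mult_exp: "frozen s x * exp (incr s x) = exp (t * comp_sum s x)"
  by (simp add: frozen_def incr_def mult_exp_exp algebra_simps)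

lemma frozen_indep: "coord_independent k (frozen s)"
  by (simp add: frozen_def comp_sum_fun_upd[OF k])

lemma mean_weight_indep: "coord_independent k (mean_weight s)"
  by (simp add: mean_weight_def)

text \<open>Truncation and passing from the maximum to a single \<open>s\<close> only decrease, and
  the weights over \<open>small_variance\<close> sum to at most 1.\<close>

lemma minorant_le_tilt:
  assumes x: "x \<in> space P"
  shows "minorant x \<le> tilt x"
proof -
  have "minorant x \<le> (\<Sum>s\<in>small_variance. mean_weight s x * tilt x)"
    unfolding minorant_def
  proof (rule sum_mono)
    fix s assume s: "s \<in> small_variance"
    have "frozen s x * \<rho> s x \<le> frozen s x * exp (incr s x)"
      unfolding \<rho>_def by (intro mult_left_mono) (auto simp: frozen_def)
    also have "\<dots> \<le> tilt x"
      unfolding frozen_mult_exp tilt_def using s small_variance t comp_sum_le_max_sum by auto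
    finally show "mean_weight s x * frozen s x * \<rho> s x \<le> mean_weight s x * tilt x"
      using mean_weight_nonneg by (simp add: mult.assoc mult_left_mono)
  qed
  also have "\<dots> \<le> (\<Sum>s\<in>S. mean_weight s x * tilt x)"
    using small_variance finite_S mean_weight_nonneg by (intro sum_mono2) (auto simp: tilt_def)
  also have "\<dots> = tilt x"
    using sum_mean_weight[OF x] by (simp flip: sum_distrib_right)
  finally show ?thesis .
qed

text \<open>Keeping the maximiser \<open>s\<close> when coordinate \<open>k\<close> is resampled
  bounds the conditional mean of \<open>tilt\<close> below by \<open>frozen s x\<close> times the
  mean of \<open>exp (t * s k y)\<close>, and that mean is at least 1 by centering. At
  \<open>x\<close> itself, \<open>tilt x = frozen s x * exp (incr s x)\<close>.\<close>

lemma log_ratio_le: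
  assumes s: "s \<in> S" and x: "x \<in> space P" and w: "max_weight s x \<noteq> 0"
  shows "log_ratio x \<le> incr s x"
proof -
  have "frozen s x * (\<integral>y. 1 + t * s k y \<partial>M k) \<le> coord_integral k tilt x"
    unfolding coord_integral_def
  proof (subst Bochner_Integration.integral_mult_right_zero[symmetric], rule integral_mono)
    fix y assume y: "y \<in> space (M k)"
    have "frozen s x * (1 + t * s k y) \<le> frozen s x * exp (t * s k y)"
      by (intro mult_left_mono) (auto simp: frozen_def)
    also have "\<dots> = exp (t * comp_sum s (x(k := y)))"
      by (simp add: frozen_def comp_sum_fun_upd[OF k] mult_exp_exp algebra_simps)
    also have "\<dots> \<le> tilt (x(k := y))"
      using comp_sum_le_max_sum[OF s] t by (simp add: tilt_def)
    finally show "frozen s x * (1 + t * s k y) \<le> tilt (x(k := y))" .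
  next
    show "integrable (M k) (\<lambda>y. tilt (x(k := y)))"
      by (intro integrable_section k x bm)
    show "integrable (M k) (\<lambda>y. frozen s x * (1 + t * s k y))"
      by (intro M.integrable_bounded_measurable bm component_bm' s k)
  qed
  also have "(\<integral>y. 1 + t * s k y \<partial>M k) = 1"
    using centered_S[OF s k] component_bm'[OF s k, THEN M.integrable_bounded_measurable]
    by (simp add: M.prob_space)
  finally have le: "frozen s x \<le> coord_integral k tilt x" by simp
  have cpos: "0 < frozen s x" by (simp add: frozen_def)
  have tilt: "tilt x = frozen s x * exp (incr s x)"
    unfolding frozen_mult_exp tilt_def using max_weight_pos_imp[OF w] by simp
  have "tilt x / coord_integral k tilt x \<le> tilt x / frozen s x"
    using le cpos by (intro divide_left_mono mult_pos_pos) (auto simp: tilt_def)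
  also have "\<dots> = exp (incr s x)" using cpos by (simp add: tilt)
  finally have "tilt x / coord_integral k tilt x \<le> exp (incr s x)" .
  moreover have "0 < tilt x / coord_integral k tilt x"
    using le cpos by (auto simp: tilt_def)
  ultimately have "ln (tilt x / coord_integral k tilt x) \<le> ln (exp (incr s x))"
    by (subst ln_le_cancel_iff) auto
  then show ?thesis by (simp add: log_ratio_def)
qed

text \<open>Averaging \<open>log_ratio x \<le> \<alpha> + max 0 (incr s x - \<alpha>)\<close> over
  the maximisers at \<open>x\<close> and multiplying by the nonnegative
  \<open>tilt x - minorant x\<close>. In the second summand \<open>minorant\<close> is simply
  dropped.\<close>

lemma remainder_le:
  assumes x: "x \<in> space P"
  shows "(tilt x - minorant x) * log_ratio x \<le> \<alpha> * (tilt x - minorant x) + tilt x * (\<Sum>s\<in>S. max_weight s x * max 0 (incr s x - \<alpha>))"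
proof -
  have "0 \<le> frozen s x" "0 \<le> \<rho> s x" for s by (auto simp: frozen_def \<rho>_def)
  then have g0: "0 \<le> minorant x" unfolding minorant_def
    by (intro sum_nonneg mult_nonneg_nonneg mean_weight_nonneg) auto
  define m where "m = (\<Sum>s\<in>S. max_weight s x * max 0 (incr s x - \<alpha>))"
  have m0: "0 \<le> m" unfolding m_def by (intro sum_nonneg mult_nonneg_nonneg max_weight_nonneg) auto
  have "log_ratio x = (\<Sum>s\<in>S. max_weight s x * log_ratio x)"
    using sum_max_weight[of x] by (simp flip: sum_distrib_right)
  also have "\<dots> \<le> (\<Sum>s\<in>S. max_weight s x * (\<alpha> + max 0 (incr s x - \<alpha>)))"
  proof (rule sum_mono)
    fix s assume "s \<in> S"
    then show "max_weight s x * log_ratio x \<le> max_weight s x * (\<alpha> + max 0 (incr s x - \<alpha>))"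
      using log_ratio_le[OF _ x, of s] max_weight_nonneg[of s x]
      by (cases "max_weight s x = 0") (auto intro!: mult_left_mono)
  qed
  also have "\<dots> = \<alpha> + m"
    by (simp add: m_def distrib_left sum.distrib sum_max_weight flip: sum_distrib_right)
  finally have "(tilt x - minorant x) * log_ratio x \<le> (tilt x - minorant x) * (\<alpha> + m)"
    using minorant_le_tilt[OF x] by (intro mult_left_mono) auto
  also have "\<dots> = \<alpha> * (tilt x - minorant x) + tilt x * m - minorant x * m" by (simp add: algebra_simps)
  also have "\<dots> \<le> \<alpha> * (tilt x - minorant x) + tilt x * m" using g0 m0 by simp
  finally show ?thesis by (simp add: m_def)
qed

text \<open>\<open>young_exp\<close> with \<open>A = \<rho> s x\<close> and \<open>B = 1\<close>
  trades \<open>log_ratio\<close> for its exponential, a conditional density. The remaining function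
  of the increment is bounded by \<open>truncated_exp_bound\<close>, a quadratic polynomial whose
  conditional mean needs only centering and variance. Everything is weighted by \<open>h\<close>,
  which is constant in \<open>x k\<close>.\<close>

lemma component_duality:
  assumes s: "s \<in> S"
  shows "(\<integral>x. mean_weight s x * frozen s x * \<rho> s x * log_ratio x \<partial>P) - \<alpha> * (\<integral>x. mean_weight s x * frozen s x * \<rho> s x \<partial>P)
    \<le> - ((\<alpha> - t\<^sup>2 * comp_var s k / 2) * (\<integral>x. max_weight s x * frozen s x \<partial>P))"
proof -
  define h where "h x = mean_weight s x * frozen s x" for x
  have h [bm]: "bounded_measurable P h" unfolding h_def using s by (intro bm)
  have h0: "0 \<le> h x" for x unfolding h_def by (simp add: mean_weight_nonneg frozen_def)
  have hi: "coord_independent k h"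
    unfolding h_def using frozen_indep mean_weight_indep by simp
  have Ef: "pos_bounded_measurable P (coord_integral k tilt)" by (intro bm k tilt_pbm)
  have ratio: "bounded_measurable P (\<lambda>x. tilt x / coord_integral k tilt x)"
    by (intro bounded_measurable_pos bm tilt_pbm Ef)
  \<comment> \<open>\<open>A\<close> carries the density and integrates like \<open>h\<close>;
    \<open>C\<close> is linear in the component and integrates to 0; \<open>D\<close> is quadratic
    and produces the variance.\<close>
  define A where "A x = h x * (tilt x / coord_integral k tilt x)" for x
  define C where "C x = h x * (\<alpha> * t * s k (x k))" for x
  define D where "D x = h x * (t\<^sup>2 / 2 * (s k (x k) * s k (x k)))" for x
  have [bm]: "bounded_measurable P A" "bounded_measurable P C" "bounded_measurable P D"
    unfolding A_def C_def D_def using s by (intro bm h ratio k; simp)+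
  have "(\<integral>x. h x * \<rho> s x * log_ratio x \<partial>P) - \<alpha> * (\<integral>x. h x * \<rho> s x \<partial>P) = (\<integral>x. h x * \<rho> s x * log_ratio x - \<alpha> * (h x * \<rho> s x) \<partial>P)"
    using s by (subst Bochner_Integration.integral_diff; (intro bm)?) simp_all
  also have "\<dots> \<le> (\<integral>x. A x - h x - (\<alpha> * h x + (C x - D x)) \<partial>P)"
  proof (rule integral_mono)
    fix x assume x: "x \<in> space P"
    have pos: "0 < tilt x / coord_integral k tilt x"
      using pos_bounded_measurable_pos[OF Ef x] by (simp add: tilt_def)
    define m where "m = min (incr s x) \<alpha>"
    have "\<rho> s x * log_ratio x \<le> \<rho> s x * m - \<rho> s x + tilt x / coord_integral k tilt x"
      using young_exp[of "\<rho> s x" 1 "log_ratio x"] pos by (simp add: \<rho>_def log_ratio_def m_def)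
    moreover have "\<alpha> + \<alpha> * incr s x - (incr s x)\<^sup>2 / 2 \<le> (1 + \<alpha> - m) * \<rho> s x - 1"
      using truncated_exp_bound[of \<alpha> "incr s x"] \<alpha> by (simp add: \<rho>_def m_def)
    ultimately have "\<rho> s x * log_ratio x - \<alpha> * \<rho> s x \<le> tilt x / coord_integral k tilt x - 1 - (\<alpha> + (\<alpha> * incr s x - (incr s x)\<^sup>2 / 2))"
      by (simp add: algebra_simps)
    from mult_left_mono[OF this h0[of x]]
    show "h x * \<rho> s x * log_ratio x - \<alpha> * (h x * \<rho> s x) \<le> A x - h x - (\<alpha> * h x + (C x - D x))"
      by (simp add: A_def C_def D_def incr_def algebra_simps power2_eq_square)
  qed (use s in \<open>intro bm h; simp\<close>)+
  also have "\<dots> = (\<integral>x. A x \<partial>P) - (\<integral>x. h x \<partial>P) -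
      (\<alpha> * (\<integral>x. h x \<partial>P) + ((\<integral>x. C x \<partial>P) - (\<integral>x. D x \<partial>P)))"
    by (simp add: bm)
  also have "(\<integral>x. A x \<partial>P) = (\<integral>x. h x \<partial>P)"
    unfolding A_def by (intro integral_mult_ratio k h hi tilt_pbm)
  also have "(\<integral>x. C x \<partial>P) = 0"
    unfolding C_def using centered_S[OF s k]
    by (subst integral_coordinate_mult[OF k h hi, of "\<lambda>y. \<alpha> * t * s k y"]) (simp_all add: bm component_bm'[OF s k])
  also have "(\<integral>x. D x \<partial>P) = t\<^sup>2 / 2 * comp_var s k * (\<integral>x. h x \<partial>P)"
  proof -
    have "bounded_measurable (M k) (\<lambda>y. t\<^sup>2 / 2 * (s k y * s k y))"
      by (intro bm component_bm'[OF s k])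
    from integral_coordinate_mult[OF k h hi this] show ?thesis
      by (simp add: D_def comp_var_def power2_eq_square[of "s k _"])
  qed
  \<comment> \<open>The averaged weight is turned back into the actual one, since
    \<open>frozen\<close> does not depend on \<open>x k\<close>. Only then can \<open>frozen\<close>
    be compared with \<open>tilt\<close> at a maximiser.\<close>
  also have "(\<integral>x. h x \<partial>P) = (\<integral>x. max_weight s x * frozen s x \<partial>P)"
    using integral_coord_integral_mult[OF k _ frozen_indep[of s] max_weight_bm[OF s]] s
    by (simp add: h_def mean_weight_def[symmetric] mult.commute bm)
  finally show ?thesis by (simp add: h_def algebra_simps)
qed

text \<open>\<open>tilt\<close> is split into \<open>tilt - minorant\<close> and
  \<open>minorant\<close>. The contributions \<open>\<alpha> * minorant\<close> from
  \<open>remainder_le\<close> are exactly those compensated in \<open>component_duality\<close>, and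
  what is left is \<open>increment_bound\<close> at each maximiser, divided by
  \<open>1 + K\<close>.\<close>

lemma entropy_increment:
  "(1 + t * exp t) * (\<integral>x. tilt x * log_ratio x \<partial>P) \<le>
     (\<integral>x. tilt x * (\<Sum>s\<in>S. max_weight s x * (t * exp t * (t * s k (x k)) + exp (2 * t) * (t\<^sup>2 * comp_var s k / 2))) \<partial>P)"
proof -
  define K where "K = t * exp t"
  define v where "v s = t\<^sup>2 * comp_var s k / 2" for s
  define R where "R x = (\<Sum>s\<in>S. max_weight s x * max 0 (incr s x - \<alpha>))" for x
  have R [bm]: "bounded_measurable P R" unfolding R_def by (intro bm)
  have goodS: "s \<in> S" if "s \<in> small_variance" for s using that small_variance by auto
  have wc [bm]: "bounded_measurable P (\<lambda>x. \<Sum>s\<in>small_variance. (\<alpha> - v s) * (max_weight s x * frozen s x))"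
    by (intro bm goodS)
  have "(\<integral>x. tilt x * log_ratio x \<partial>P) = (\<integral>x. (tilt x - minorant x) * log_ratio x + minorant x * log_ratio x \<partial>P)"
    by (simp add: algebra_simps)
  also have "\<dots> \<le> (\<integral>x. \<alpha> * (tilt x - minorant x) + tilt x * R x + minorant x * log_ratio x \<partial>P)"
    by (rule integral_mono) (use remainder_le in \<open>auto intro!: bm simp: R_def\<close>)
  also have "\<dots> = (\<integral>x. \<alpha> * tilt x + tilt x * R x \<partial>P) + ((\<integral>x. minorant x * log_ratio x \<partial>P) - (\<integral>x. \<alpha> * minorant x \<partial>P))"
    by (subst Bochner_Integration.integral_diff[symmetric] Bochner_Integration.integral_add[symmetric]; (intro bm)?)+
      (simp add: algebra_simps)
  also have "(\<integral>x. minorant x * log_ratio x \<partial>P) - (\<integral>x. \<alpha> * minorant x \<partial>P) =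
      (\<Sum>s\<in>small_variance. (\<integral>x. mean_weight s x * frozen s x * \<rho> s x * log_ratio x \<partial>P) - \<alpha> * (\<integral>x. mean_weight s x * frozen s x * \<rho> s x \<partial>P))"
  proof -
    have "(\<integral>x. minorant x * log_ratio x \<partial>P) = (\<Sum>s\<in>small_variance. \<integral>x. mean_weight s x * frozen s x * \<rho> s x * log_ratio x \<partial>P)"
      unfolding minorant_def sum_distrib_right by (intro Bochner_Integration.integral_sum bm goodS)
    moreover have "(\<integral>x. minorant x \<partial>P) = (\<Sum>s\<in>small_variance. \<integral>x. mean_weight s x * frozen s x * \<rho> s x \<partial>P)"
      unfolding minorant_def by (intro Bochner_Integration.integral_sum bm goodS)
    ultimately show ?thesis by (simp add: sum_subtractf sum_distrib_left)
  qed
  also have "\<dots> \<le> (\<Sum>s\<in>small_variance. - ((\<alpha> - v s) * (\<integral>x. max_weight s x * frozen s x \<partial>P)))"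
    unfolding v_def by (intro sum_mono component_duality goodS)
  also have "\<dots> = - (\<integral>x. (\<Sum>s\<in>small_variance. (\<alpha> - v s) * (max_weight s x * frozen s x)) \<partial>P)"
    by (subst Bochner_Integration.integral_sum) (auto intro!: bm goodS simp: sum_negf)
  also have "(\<integral>x. \<alpha> * tilt x + tilt x * R x \<partial>P) + - (\<integral>x. (\<Sum>s\<in>small_variance. (\<alpha> - v s) * (max_weight s x * frozen s x)) \<partial>P) =
     (\<integral>x. \<alpha> * tilt x + tilt x * R x - (\<Sum>s\<in>small_variance. (\<alpha> - v s) * (max_weight s x * frozen s x)) \<partial>P)"
    by (subst Bochner_Integration.integral_diff) (auto intro!: bm goodS)
  finally have "(\<integral>x. tilt x * log_ratio x \<partial>P) \<le> \<dots>" by simp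
  then have "(1 + K) * (\<integral>x. tilt x * log_ratio x \<partial>P) \<le> (1 + K) * \<dots>"
    using t by (intro mult_left_mono) (auto simp: K_def)
  also have "\<dots> = (\<integral>x. (1 + K) * (\<alpha> * tilt x + tilt x * R x - (\<Sum>s\<in>small_variance. (\<alpha> - v s) * (max_weight s x * frozen s x))) \<partial>P)"
    by simp
  also have "\<dots> \<le> (\<integral>x. tilt x * (\<Sum>s\<in>S. max_weight s x * (K * (t * s k (x k)) + exp (2 * t) * v s)) \<partial>P)"
  proof (rule integral_mono)
    fix x assume x: "x \<in> space P"
    have K0: "0 < 1 + K" using t by (auto simp: K_def intro: add_pos_pos)
    have "(\<Sum>s\<in>small_variance. (\<alpha> - v s) * (max_weight s x * frozen s x)) = (\<Sum>s\<in>S. max 0 (\<alpha> - v s) * (max_weight s x * frozen s x))"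
      \<comment> \<open>Restricting to \<open>small_variance\<close> is the same as taking the
        positive part of \<open>\<alpha> - v s\<close> over all of \<open>S\<close>.\<close>
      by (rule sum.mono_neutral_cong_left) (use finite_S in \<open>auto simp: small_variance_def v_def\<close>)
    also have "\<dots> = (\<Sum>s\<in>S. tilt x * (max_weight s x * (exp (- incr s x) * max 0 (\<alpha> - v s))))"
    proof (rule sum.cong[OF refl])
      fix s assume "s \<in> S"
      show "max 0 (\<alpha> - v s) * (max_weight s x * frozen s x) = tilt x * (max_weight s x * (exp (- incr s x) * max 0 (\<alpha> - v s)))"
      proof (cases "max_weight s x = 0")
        case False
        have "frozen s x = tilt x * exp (- incr s x)"
          using max_weight_pos_imp[OF False] by (simp add: frozen_def tilt_def incr_def mult_exp_exp algebra_simps)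
        then show ?thesis by simp
      qed simp
    qed
    finally have small_variance: "(\<Sum>s\<in>small_variance. (\<alpha> - v s) * (max_weight s x * frozen s x)) = \<dots>" .
    have "\<alpha> * tilt x = (\<Sum>s\<in>S. tilt x * (max_weight s x * \<alpha>))"
      by (simp add: sum_max_weight flip: sum_distrib_left sum_distrib_right)
    then have "(1 + K) * (\<alpha> * tilt x + tilt x * R x - (\<Sum>s\<in>small_variance. (\<alpha> - v s) * (max_weight s x * frozen s x))) =
      tilt x * (\<Sum>s\<in>S. max_weight s x * ((1 + K) * (\<alpha> + max 0 (incr s x - \<alpha>) - exp (- incr s x) * max 0 (\<alpha> - v s))))"
      unfolding small_variance R_def
      by (simp add: sum_distrib_left sum.distrib sum_subtractf algebra_simps)
    also have "\<dots> \<le> tilt x * (\<Sum>s\<in>S. max_weight s x * (K * (t * s k (x k)) + exp (2 * t) * v s))"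
    proof (intro mult_left_mono sum_mono max_weight_nonneg)
      fix s assume s: "s \<in> S"
      have "\<bar>incr s x\<bar> \<le> t * 1"
        unfolding incr_def abs_mult using bounded_S[OF s k] t by (intro mult_mono) auto
      moreover have "0 \<le> v s" "v s \<le> t\<^sup>2 / 2"
        using comp_var_bounds[OF s k] mult_left_mono[of "comp_var s k" 1 "t\<^sup>2"] by (auto simp: v_def)
      ultimately have "K + max 0 ((1 + K) * incr s x - K) - exp (- incr s x) * max 0 (K - (1 + K) * v s)
          \<le> K * incr s x + exp (2 * t) * v s"
        using increment_bound[OF t] by (simp add: K_def)
      moreover have "(1 + K) * \<alpha> = K" using \<alpha> by (simp add: K_def mult.commute)
      moreover have "(1 + K) * max 0 (incr s x - \<alpha>) = max 0 ((1 + K) * incr s x - (1 + K) * \<alpha>)"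
        "(1 + K) * max 0 (\<alpha> - v s) = max 0 ((1 + K) * \<alpha> - (1 + K) * v s)"
        using K0 by (simp_all add: max_mult_distrib_left right_diff_distrib)
      ultimately show "(1 + K) * (\<alpha> + max 0 (incr s x - \<alpha>) - exp (- incr s x) * max 0 (\<alpha> - v s))
          \<le> K * (t * s k (x k)) + exp (2 * t) * v s"
        by (simp add: right_diff_distrib distrib_left[of "1 + K"] mult.left_commute[of "1 + K"] incr_def)
    qed (simp add: tilt_def)
    finally show "(1 + K) * (\<alpha> * tilt x + tilt x * R x - (\<Sum>s\<in>small_variance. (\<alpha> - v s) * (max_weight s x * frozen s x))) \<le> \<dots>" .
  next
    show "integrable P (\<lambda>x. tilt x * (\<Sum>s\<in>S. max_weight s x * (K * (t * s k (x k)) + exp (2 * t) * v s)))"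
      by (intro bm k)
  qed (intro bm goodS)
  finally show ?thesis unfolding K_def v_def .
qed

end

end

text \<open>The weight of a maximiser is the same for every \<open>k\<close>, so the sums over
  \<open>k\<close> and \<open>s\<close> can be exchanged; then the increments add up to
  \<open>t * max_sum x\<close> and the variances to at most \<open>V\<close>.\<close>

lemma entropy_bound:
  assumes t: "0 < t" and V: "\<And>s. s \<in> S \<Longrightarrow> (\<Sum>k\<in>I. comp_var s k) \<le> V"
  defines "F \<equiv> (\<integral>x. exp (t * max_sum x) \<partial>P)" and "F' \<equiv> (\<integral>x. max_sum x * exp (t * max_sum x) \<partial>P)"
  shows "(1 + t * exp t) * (t * F' - F * ln F) \<le> t\<^sup>2 * exp t * F' + exp (2 * t) * t\<^sup>2 / 2 * V * F"
proof -
  have tilt_eq: "tilt t x = exp (t * max_sum x)" for x by (simp add: tilt_def)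
  define f where "f = (\<lambda>x. exp (t * max_sum x))"
  have f: "pos_bounded_measurable P f" unfolding f_def by (intro bm)
  have e [bm]: "bounded_measurable P (\<lambda>x. exp (t * max_sum x))"
    by (intro bounded_measurable_pos bm)
  have tilt_f: "tilt t = f" by (simp add: f_def tilt_eq fun_eq_iff)
  have "(\<integral>x. f x * ln (f x) \<partial>P) = (\<integral>x. t * (max_sum x * exp (t * max_sum x)) \<partial>P)"
    by (simp add: f_def algebra_simps)
  also have "\<dots> = t * F'" by (simp add: F'_def)
  finally have H: "t * F' - F * ln F \<le> (\<Sum>k\<in>I. \<integral>x. f x * ln (f x / coord_integral k f x) \<partial>P)"
    using entropy_tensorization[OF f] by (simp add: F_def f_def)
  have inc: "(1 + t * exp t) * (\<integral>x. f x * ln (f x / coord_integral k f x) \<partial>P) \<le>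
     (\<integral>x. f x * (\<Sum>s\<in>S. max_weight s x * (t * exp t * (t * s k (x k)) + exp (2 * t) * (t\<^sup>2 * comp_var s k / 2))) \<partial>P)"
    if "k \<in> I" for k
    using entropy_increment[OF t that] unfolding log_ratio_def tilt_f by simp
  have "(1 + t * exp t) * (t * F' - F * ln F) \<le>
      (\<Sum>k\<in>I. (1 + t * exp t) * (\<integral>x. f x * ln (f x / coord_integral k f x) \<partial>P))"
    unfolding sum_distrib_left[symmetric] using H t by (intro mult_left_mono) auto
  also have "\<dots> \<le> (\<Sum>k\<in>I. \<integral>x. f x * (\<Sum>s\<in>S. max_weight s x * (t * exp t * (t * s k (x k)) + exp (2 * t) * (t\<^sup>2 * comp_var s k / 2))) \<partial>P)"
    by (intro sum_mono inc)
  also have "\<dots> = (\<integral>x. (\<Sum>k\<in>I. f x * (\<Sum>s\<in>S. max_weight s x * (t * exp t * (t * s k (x k)) + exp (2 * t) * (t\<^sup>2 * comp_var s k / 2)))) \<partial>P)"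
    by (intro Bochner_Integration.integral_sum[symmetric] bm bounded_measurable_pos[OF f])
  also have "\<dots> \<le> (\<integral>x. t\<^sup>2 * exp t * (max_sum x * exp (t * max_sum x)) + exp (2 * t) * t\<^sup>2 / 2 * V * exp (t * max_sum x) \<partial>P)"
  proof (rule integral_mono)
    fix x assume x: "x \<in> space P"
    have "(\<Sum>k\<in>I. f x * (\<Sum>s\<in>S. max_weight s x * (t * exp t * (t * s k (x k)) + exp (2 * t) * (t\<^sup>2 * comp_var s k / 2)))) =
      f x * (\<Sum>s\<in>S. max_weight s x * (\<Sum>k\<in>I. t * exp t * (t * s k (x k)) + exp (2 * t) * (t\<^sup>2 * comp_var s k / 2)))"
      by (simp only: sum_distrib_left sum.swap[of _ I])
    also have "\<dots> \<le> f x * (\<Sum>s\<in>S. max_weight s x * (t\<^sup>2 * exp t * max_sum x + exp (2 * t) * t\<^sup>2 / 2 * V))"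
    proof (rule mult_left_mono[OF sum_mono])
      fix s assume s: "s \<in> S"
      show "max_weight s x * (\<Sum>k\<in>I. t * exp t * (t * s k (x k)) + exp (2 * t) * (t\<^sup>2 * comp_var s k / 2)) \<le>
          max_weight s x * (t\<^sup>2 * exp t * max_sum x + exp (2 * t) * t\<^sup>2 / 2 * V)"
      proof (cases "max_weight s x = 0")
        case False
        have "(\<Sum>k\<in>I. t * exp t * (t * s k (x k)) + exp (2 * t) * (t\<^sup>2 * comp_var s k / 2)) =
            t\<^sup>2 * exp t * comp_sum s x + exp (2 * t) * t\<^sup>2 / 2 * (\<Sum>k\<in>I. comp_var s k)"
          by (simp add: sum.distrib comp_sum_def sum_distrib_left sum_distrib_right power2_eq_square mult_ac)
        also have "\<dots> \<le> t\<^sup>2 * exp t * max_sum x + exp (2 * t) * t\<^sup>2 / 2 * V"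
          using max_weight_pos_imp[OF False] V[OF s] by (simp add: mult_left_mono)
        finally show ?thesis by (intro mult_left_mono max_weight_nonneg)
      qed simp
    qed (simp add: f_def)
    also have "\<dots> = t\<^sup>2 * exp t * (max_sum x * exp (t * max_sum x)) + exp (2 * t) * t\<^sup>2 / 2 * V * exp (t * max_sum x)"
      by (simp only: sum_distrib_right[symmetric] sum_max_weight) (simp add: f_def algebra_simps)
    finally show "(\<Sum>k\<in>I. f x * (\<Sum>s\<in>S. max_weight s x * (t * exp t * (t * s k (x k)) + exp (2 * t) * (t\<^sup>2 * comp_var s k / 2)))) \<le> \<dots>" .
  next
    show "integrable P (\<lambda>x. t\<^sup>2 * exp t * (max_sum x * exp (t * max_sum x)) + exp (2 * t) * t\<^sup>2 / 2 * V * exp (t * max_sum x))"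
      by (intro bm e)
  qed (intro bm bounded_measurable_pos[OF f])
  also have "\<dots> = t\<^sup>2 * exp t * F' + exp (2 * t) * t\<^sup>2 / 2 * V * F"
  proof -
    have "integrable P (\<lambda>x. t\<^sup>2 * exp t * (max_sum x * exp (t * max_sum x)))"
      "integrable P (\<lambda>x. exp (2 * t) * t\<^sup>2 / 2 * V * exp (t * max_sum x))"
      by (intro bm e)+
    from Bochner_Integration.integral_add[OF this] show ?thesis
      by (simp add: F_def F'_def)
  qed
  finally show ?thesis .
qed

end

section \<open>From entropy to deviations\<close>

text \<open>From \<open>exp w * (1 - w) \<le> 1\<close>, with
  \<open>1 - w \<ge> 1 / 2\<close>.\<close>

lemma exp_quadratic_remainder:
  fixes w :: real
  assumes "\<bar>w\<bar> \<le> 1 / 2"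
  shows "\<bar>exp w - 1 - w\<bar> \<le> 2 * w\<^sup>2"
proof -
  have "exp w * (1 - w) \<le> exp w * exp (- w)"
    using exp_ge_add_one_self[of "- w"] by (intro mult_left_mono) auto
  then have "exp w * (1 - w) \<le> 1" by (simp add: mult_exp_exp)
  then have *: "(exp w - 1 - w) * (1 - w) \<le> w\<^sup>2"
    by (simp add: algebra_simps power2_eq_square)
  have pos: "0 \<le> exp w - 1 - w" using exp_ge_add_one_self[of w] by linarith
  have "(exp w - 1 - w) * (1 / 2) \<le> (exp w - 1 - w) * (1 - w)"
    using assms pos by (intro mult_left_mono) auto
  then show ?thesis using * pos by simp
qed

section \<open>Laplace transforms of bounded random variables\<close>

context prob_space
begin

lemma integrable_bounded_times_exp:
  fixes Z :: "'a \<Rightarrow> real"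
  assumes Z: "Z \<in> borel_measurable M" and B: "\<And>x. x \<in> space M \<Longrightarrow> \<bar>Z x\<bar> \<le> B"
  shows "integrable M (\<lambda>x. Z x ^ m * exp (t * Z x))"
proof (rule integrable_const_bound[where B = "B ^ m * exp (\<bar>t\<bar> * B)"])
  have "\<bar>Z x ^ m * exp (t * Z x)\<bar> \<le> B ^ m * exp (\<bar>t\<bar> * B)" if "x \<in> space M" for x
  proof -
    have "\<bar>t * Z x\<bar> \<le> \<bar>t\<bar> * B"
      unfolding abs_mult using B[OF that] by (intro mult_left_mono) auto
    then have "t * Z x \<le> \<bar>t\<bar> * B" by linarith
    then show ?thesis
      unfolding abs_mult power_abs using B[OF that] by (intro mult_mono power_mono) auto
  qed
  then show "AE x in M. norm (Z x ^ m * exp (t * Z x)) \<le> B ^ m * exp (\<bar>t\<bar> * B)"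
    by auto
qed (use Z in measurable)

text \<open>The quadratic remainder of \<open>exp\<close>, uniform because \<open>Z\<close> is
  bounded, makes the error of the difference quotient linear in \<open>h\<close>.\<close>

lemma DERIV_laplace_transform:
  fixes Z :: "'a \<Rightarrow> real"
  assumes Z: "Z \<in> borel_measurable M" and B: "\<And>x. x \<in> space M \<Longrightarrow> \<bar>Z x\<bar> \<le> B"
  shows "((\<lambda>t. expectation (\<lambda>x. exp (t * Z x))) has_real_derivative
           expectation (\<lambda>x. Z x * exp (t * Z x))) (at t)"
proof -
  define F where "F u = expectation (\<lambda>x. exp (u * Z x))" for u
  define F' where "F' = expectation (\<lambda>x. Z x * exp (t * Z x))"
  \<comment> \<open>Keeps the radius \<open>1 / (2 * C)\<close> meaningful when
    \<open>B = 0\<close>; within it \<open>\<bar>h * Z x\<bar> \<le> 1 / 2\<close>.\<close>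
  define C where "C = max B 1"
  have C: "\<And>x. x \<in> space M \<Longrightarrow> \<bar>Z x\<bar> \<le> C" "1 \<le> C" using B by (force simp: C_def)+
  have int: "integrable M (\<lambda>x. exp (u * Z x))" "integrable M (\<lambda>x. Z x * exp (u * Z x))" for u
    using integrable_bounded_times_exp[OF Z B, of 0 u] integrable_bounded_times_exp[OF Z B, of 1 u] by auto
  have bound: "\<bar>(F (t + h) - F t) / h - F'\<bar> \<le> 2 * C\<^sup>2 * F t * \<bar>h\<bar>" if h: "h \<noteq> 0" "\<bar>h\<bar> < 1 / (2 * C)" for h
  proof -
    have "F (t + h) - F t - h * F' =
        expectation (\<lambda>x. exp ((t + h) * Z x) - exp (t * Z x) - h * (Z x * exp (t * Z x)))"
      unfolding F_def F'_def using int by simp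
    also have "\<bar>\<dots>\<bar> \<le> expectation (\<lambda>x. 2 * C\<^sup>2 * h\<^sup>2 * exp (t * Z x))"
    proof (rule order_trans[OF integral_abs_bound integral_mono])
      fix x assume x: "x \<in> space M"
      have hZ: "\<bar>h * Z x\<bar> \<le> \<bar>h\<bar> * C" unfolding abs_mult using C(1)[OF x] by (intro mult_left_mono) auto
      also have "\<dots> \<le> 1 / 2" using h C(2) by (simp add: field_simps)
      finally have "\<bar>exp (h * Z x) - 1 - h * Z x\<bar> \<le> 2 * (h * Z x)\<^sup>2"
        by (rule exp_quadratic_remainder)
      also have "\<dots> \<le> 2 * C\<^sup>2 * h\<^sup>2"
        using power_mono[OF hZ, of 2] by (simp add: power_mult_distrib mult.commute)
      finally have "exp (t * Z x) * \<bar>exp (h * Z x) - 1 - h * Z x\<bar> \<le> exp (t * Z x) * (2 * C\<^sup>2 * h\<^sup>2)"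
        by (intro mult_left_mono) auto
      moreover have "exp ((t + h) * Z x) - exp (t * Z x) - h * (Z x * exp (t * Z x)) =
          exp (t * Z x) * (exp (h * Z x) - 1 - h * Z x)"
        by (simp add: algebra_simps flip: exp_add)
      ultimately show "\<bar>exp ((t + h) * Z x) - exp (t * Z x) - h * (Z x * exp (t * Z x))\<bar>
          \<le> 2 * C\<^sup>2 * h\<^sup>2 * exp (t * Z x)"
        by (simp add: abs_mult mult_ac)
    qed (use int in auto)
    also have "\<dots> = 2 * C\<^sup>2 * F t * h\<^sup>2" by (simp add: F_def)
    finally have "\<bar>F (t + h) - F t - h * F'\<bar> / \<bar>h\<bar> \<le> 2 * C\<^sup>2 * F t * h\<^sup>2 / \<bar>h\<bar>"
      by (intro divide_right_mono) auto
    also have "\<dots> = 2 * C\<^sup>2 * F t * \<bar>h\<bar>"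
      using h(1) by (simp add: power2_eq_square field_simps abs_if)
    also have "\<bar>F (t + h) - F t - h * F'\<bar> / \<bar>h\<bar> = \<bar>(F (t + h) - F t) / h - F'\<bar>"
      using h(1) by (simp add: field_simps flip: abs_divide)
    finally show ?thesis .
  qed
  have "(\<lambda>h. (F (t + h) - F t) / h - F') \<midarrow>0\<rightarrow> 0"
  proof (rule Lim_null_comparison)
    have "0 < 1 / (2 * C)" using C(2) by simp
    then show "\<forall>\<^sub>F h in at 0. norm ((F (t + h) - F t) / h - F') \<le> 2 * C\<^sup>2 * F t * \<bar>h\<bar>"
      unfolding eventually_at using bound by (intro exI[of _ "1 / (2 * C)"]) (auto simp: dist_real_def)
    show "(\<lambda>h. 2 * C\<^sup>2 * F t * \<bar>h\<bar>) \<midarrow>0\<rightarrow> 0"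
      by (auto intro!: tendsto_eq_intros)
  qed
  then show ?thesis
    unfolding DERIV_def F_def F'_def by (simp add: LIM_zero_iff)
qed

lemma laplace_transform_ge:
  fixes Z :: "'a \<Rightarrow> real"
  assumes Z: "Z \<in> borel_measurable M" and B: "\<And>x. x \<in> space M \<Longrightarrow> \<bar>Z x\<bar> \<le> B"
  shows "1 + t * expectation Z \<le> expectation (\<lambda>x. exp (t * Z x))"
proof -
  have "integrable M Z" "integrable M (\<lambda>x. exp (t * Z x))"
    using integrable_bounded_times_exp[OF Z B, of 1 0] integrable_bounded_times_exp[OF Z B, of 0 t] by auto
  then have "expectation (\<lambda>x. 1 + t * Z x) \<le> expectation (\<lambda>x. exp (t * Z x))"
    by (intro integral_mono) auto
  then show ?thesis using \<open>integrable M Z\<close> by (simp add: prob_space)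
qed

text \<open>
  The entropy inequality says that \<open>(L t / t + V / 2) * exp (- (exp (2 * t) - 1) / 2)\<close> is
  nonincreasing, where \<open>L\<close> is the logarithm of the Laplace transform.
\<close>

lemma log_laplace_from_entropy_bound:
  fixes Z :: "'a \<Rightarrow> real"
  assumes Z: "Z \<in> borel_measurable M" and B: "\<And>x. x \<in> space M \<Longrightarrow> \<bar>Z x\<bar> \<le> B"
    and EZ: "0 \<le> expectation Z"
    and ineq: "\<And>t. 0 < t \<Longrightarrow>
      (1 + t * exp t) * (t * expectation (\<lambda>x. Z x * exp (t * Z x)) -
          expectation (\<lambda>x. exp (t * Z x)) * ln (expectation (\<lambda>x. exp (t * Z x)))) \<le>
        t\<^sup>2 * exp t * expectation (\<lambda>x. Z x * exp (t * Z x)) +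
        exp (2 * t) * t\<^sup>2 / 2 * V * expectation (\<lambda>x. exp (t * Z x))"
    and t: "0 < t"
  shows "ln (expectation (\<lambda>x. exp (t * Z x))) \<le>
    t * expectation Z + t / 2 * (2 * expectation Z + V) * (exp ((exp (2 * t) - 1) / 2) - 1)"
proof -
  define F where "F u = expectation (\<lambda>x. exp (u * Z x))" for u
  define F' where "F' u = expectation (\<lambda>x. Z x * exp (u * Z x))" for u
  define L where "L u = ln (F u)" for u
  define G where "G u = (L u / u + V / 2) * exp (- ((exp (2 * u) - 1) / 2))" for u
  define m where "m = expectation Z"
  have Fd: "(F has_real_derivative F' u) (at u)" for u
    using DERIV_laplace_transform[OF Z B] unfolding F_def[abs_def] F'_def by simp
  have F1: "1 \<le> F u" if "0 \<le> u" for u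
    using laplace_transform_ge[OF Z B, of u] mult_nonneg_nonneg[OF that EZ] by (simp add: F_def)
  have Ld: "(L has_real_derivative F' u / F u) (at u)" if "0 \<le> u" for u
    unfolding L_def[abs_def] using F1[OF that] by (auto intro!: derivative_eq_intros Fd simp: field_simps)
  have L0: "L 0 = 0" "F 0 = 1" "F' 0 = m" by (simp_all add: L_def F_def F'_def m_def prob_space)
  have ode: "u * (F' u / F u) - L u \<le> exp (2 * u) * (u * L u + u\<^sup>2 * (V / 2))" if u: "0 < u" for u
  proof -
    have Fu: "1 \<le> F u" using F1 u by simp
    have Lu: "0 \<le> L u" using Fu by (simp add: L_def)
    define l where "l = F' u / F u"
    have F': "F' u = F u * l" using Fu by (simp add: l_def)
    have "F u * ((1 + u * exp u) * (u * l - L u)) \<le> F u * (u\<^sup>2 * exp u * l + exp (2 * u) * u\<^sup>2 / 2 * V)"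
      using ineq[OF u, folded F_def F'_def, folded L_def, unfolded F'] by (simp add: algebra_simps)
    then have "(1 + u * exp u) * (u * l - L u) \<le> u\<^sup>2 * exp u * l + exp (2 * u) * u\<^sup>2 / 2 * V"
      using Fu by simp
    \<comment> \<open>The term \<open>u * exp u * (u * l)\<close> on the left cancels
      \<open>u\<^sup>2 * exp u * l\<close> on the right.\<close>
    then have "u * l - L u \<le> exp u * (u * L u) + exp (2 * u) * (u\<^sup>2 * (V / 2))"
      by (simp add: algebra_simps power2_eq_square)
    \<comment> \<open>\<open>L u \<ge> 0\<close>, which comes from the nonnegative mean, permits the
      common factor \<open>exp (2 * u)\<close>.\<close>
    also have "exp u * (u * L u) \<le> exp (2 * u) * (u * L u)"
      using u Lu by (intro mult_right_mono) auto
    finally show ?thesis by (simp add: l_def algebra_simps)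
  qed
  have mono: "G t \<le> G u" if u: "0 < u" "u \<le> t" for u
  proof (rule DERIV_nonpos_imp_nonincreasing[OF u(2)])
    fix y assume y: "u \<le> y" "y \<le> t"
    with u have y0: "0 < y" by simp
    define E where "E = exp (- ((exp (2 * y) - 1) / 2))"
    define l where "l = F' y / F y"
    have "(G has_real_derivative ((l * y - L y) / (y * y)) * E +
        (L y / y + V / 2) * (E * - (exp (2 * y)))) (at y)"
      unfolding G_def[abs_def] E_def l_def using y0 Ld[of y]
      by (auto intro!: derivative_eq_intros simp: field_simps)
    moreover have "((l * y - L y) / (y * y)) * E + (L y / y + V / 2) * (E * - (exp (2 * y))) \<le> 0"
    proof -
      have "(l * y - L y) / (y * y) \<le> exp (2 * y) * (y * L y + y\<^sup>2 * (V / 2)) / (y * y)"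
        using ode[OF y0] by (intro divide_right_mono) (auto simp: l_def mult.commute)
      also have "\<dots> = exp (2 * y) * (L y / y + V / 2)"
        using y0 by (simp add: field_simps power2_eq_square)
      finally have "(l * y - L y) / (y * y) * E \<le> exp (2 * y) * (L y / y + V / 2) * E"
        by (intro mult_right_mono) (auto simp: E_def)
      then show ?thesis by (simp add: algebra_simps)
    qed
    ultimately show "\<exists>d. (G has_real_derivative d) (at y) \<and> d \<le> 0" by blast
  qed
  \<comment> \<open>The value of \<open>G\<close> at 0 is the limit of \<open>L u / u\<close>, that
    is, the derivative of \<open>L\<close> at 0, which is the mean.\<close>
  have "((\<lambda>u. (L u - L 0) / (u - 0)) \<longlongrightarrow> m) (at 0)"
    using Ld[of 0] unfolding has_field_derivative_iff by (simp add: L0)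
  then have "((\<lambda>u. L u / u) \<longlongrightarrow> m) (at_right 0)"
    by (simp add: L0 filterlim_at_split)
  then have "(G \<longlongrightarrow> (m + V / 2) * exp (- ((exp (2 * 0) - 1) / 2))) (at_right 0)"
    unfolding G_def[abs_def] by (intro tendsto_intros) auto
  then have lim: "(G \<longlongrightarrow> m + V / 2) (at_right 0)" by simp
  have "G t \<le> m + V / 2"
  proof (rule tendsto_lowerbound[OF lim])
    show "\<forall>\<^sub>F u in at_right 0. G t \<le> G u"
      using mono t by (auto simp: eventually_at_right_field intro!: exI[of _ t])
  qed simp
  then have "(L t / t + V / 2) * exp (- ((exp (2 * t) - 1) / 2)) * exp ((exp (2 * t) - 1) / 2) \<le>
      (m + V / 2) * exp ((exp (2 * t) - 1) / 2)"
    unfolding G_def by (intro mult_right_mono) auto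
  then have "L t / t + V / 2 \<le> (m + V / 2) * exp ((exp (2 * t) - 1) / 2)"
    by (simp add: mult.assoc mult_exp_exp)
  then have "t * (L t / t) \<le> t * ((m + V / 2) * exp ((exp (2 * t) - 1) / 2) - V / 2)"
    using t by (intro mult_left_mono) auto
  then show ?thesis
    using t unfolding L_def F_def m_def by (simp add: algebra_simps)
qed

lemma deviation_from_log_laplace:
  fixes Z :: "'a \<Rightarrow> real"
  assumes Z: "Z \<in> borel_measurable M" and B: "\<And>x. x \<in> space M \<Longrightarrow> \<bar>Z x\<bar> \<le> B"
    and L: "\<And>t. 0 < t \<Longrightarrow> ln (expectation (\<lambda>x. exp (t * Z x))) \<le>
      t * expectation Z + t / 2 * v * (exp ((exp (2 * t) - 1) / 2) - 1)"
    and v: "0 \<le> v" and x: "0 < x"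
  defines "p \<equiv> prob {\<omega> \<in> space M. expectation Z + x \<le> Z \<omega>}"
  shows "p \<le> (if v = 0 then 0 else exp (- (x / 4) * ln (1 + 2 * ln (1 + x / v))))"
    and "p \<le> exp (- (x\<^sup>2 / (v + sqrt (v\<^sup>2 + 3 * v * x) + 3 * x / 2)))"
proof -
  have chernoff: "p \<le> exp (t / 2 * v * (exp ((exp (2 * t) - 1) / 2) - 1) - t * x)" if t: "0 < t" for t
  proof -
    define F where "F = expectation (\<lambda>x. exp (t * Z x))"
    have int: "integrable M (\<lambda>x. exp (t * Z x))"
      using integrable_bounded_times_exp[OF Z B, of 0 t] by simp
    have pos: "0 < F"
    proof -
      have "- (t * B) \<le> t * Z x" if "x \<in> space M" for x
        using mult_left_mono[of "- B" "Z x" t] B[OF that] t by auto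
      then have "expectation (\<lambda>_. exp (- (t * B))) \<le> F" unfolding F_def
        using int by (intro integral_mono) auto
      then show ?thesis by (simp add: prob_space) (meson exp_gt_zero less_le_trans)
    qed
    have "p = prob {\<omega> \<in> space M. exp (t * (expectation Z + x)) \<le> exp (t * Z \<omega>)}"
      using t by (simp add: p_def)
    also have "\<dots> \<le> F / exp (t * (expectation Z + x))"
      unfolding F_def by (rule integral_Markov_inequality_measure[where A = "{}"]) (use int in auto)
    also have "\<dots> = exp (- t * (expectation Z + x)) * F"
      by (simp add: exp_minus divide_inverse mult.commute)
    finally have "p \<le> exp (- t * (expectation Z + x)) * F" .
    also have "F = exp (ln F)" using pos by simp
    also have "exp (- t * (expectation Z + x)) * exp (ln F) \<le>
        exp (- t * (expectation Z + x)) * exp (t * expectation Z + t / 2 * v * (exp ((exp (2 * t) - 1) / 2) - 1))"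
      using L[OF t] unfolding F_def by (intro mult_left_mono) auto
    also have "\<dots> = exp (t / 2 * v * (exp ((exp (2 * t) - 1) / 2) - 1) - t * x)"
      by (simp add: mult_exp_exp algebra_simps)
    finally show ?thesis .
  qed
  have zero: "p \<le> 0" if "v = 0"
  proof (rule ccontr)
    assume "\<not> p \<le> 0"
    then have p: "0 < p" by simp
    have "p \<le> 1" unfolding p_def by simp
    then have "ln p \<le> 0" using p by simp
    \<comment> \<open>For \<open>v = 0\<close> the exponent is \<open>- t * x\<close> with
      \<open>t\<close> free; this \<open>t\<close> makes the bound \<open>exp (ln p - 1)\<close>,
      smaller than \<open>p\<close> itself.\<close>
    then have "0 < (1 - ln p) / x" using x by (intro divide_pos_pos) auto
    from chernoff[OF this] have "p \<le> exp (ln p - 1)" using x that by simp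
    also have "\<dots> < exp (ln p)" by simp
    finally show False using p by simp
  qed
  show "p \<le> (if v = 0 then 0 else exp (- (x / 4) * ln (1 + 2 * ln (1 + x / v))))"
  proof (cases "v = 0")
    case False
    with v have v: "0 < v" by simp
    \<comment> \<open>Chosen so that \<open>exp ((exp (2 * t) - 1) / 2) = 1 + x / v\<close>; the
      exponent becomes \<open>t * x / 2 - t * x\<close>.\<close>
    define t where "t = ln (1 + 2 * ln (1 + x / v)) / 2"
    have pos: "0 < ln (1 + x / v)" using x v by (intro ln_gt_zero) auto
    then have t: "0 < t" unfolding t_def by (intro divide_pos_pos ln_gt_zero) auto
    have "exp (2 * t) = 1 + 2 * ln (1 + x / v)" using pos unfolding t_def by simp
    then have "exp ((exp (2 * t) - 1) / 2) = 1 + x / v" using x v by (simp add: add_pos_pos)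
    then have "p \<le> exp (- (t / 2 * x))" using chernoff[OF t] v by simp
    then show ?thesis using False by (simp add: t_def mult.commute)
  qed (use zero in simp)
  show "p \<le> exp (- (x\<^sup>2 / (v + sqrt (v\<^sup>2 + 3 * v * x) + 3 * x / 2)))"
  proof (cases "v = 0")
    case False
    with v have v: "0 < v" by simp
    define D where "D = sqrt (v\<^sup>2 + 3 * v * x)"
    have D2: "D\<^sup>2 = v\<^sup>2 + 3 * v * x" using v x by (simp add: D_def)
    have "v\<^sup>2 < D\<^sup>2" using v x by (simp add: D2)
    then have D: "v < D" by (rule power_less_imp_less_base) (use v x in \<open>simp add: D_def\<close>)
    define u w where "u = D - v" and "w = D + v"
    have u: "0 < u" "u < D" and w: "0 < w" using D v by (simp_all add: u_def w_def)
    have "3 * v * x = u * w" using D2 by (simp add: u_def w_def algebra_simps power2_eq_square)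
    then have xu: "x = u * w / (3 * v)" using v by (simp add: field_simps)
    \<comment> \<open>The minimiser of \<open>v * t\<^sup>2 / (2 - 3 * t) - t * x\<close>: the
      critical equation is \<open>4 / (2 - 3 * t)\<^sup>2 = 1 + 3 * x / v\<close>, so
      \<open>2 - 3 * t = 2 * v / D\<close>.\<close>
    define t where "t = 2 / 3 * u / D"
    have t: "0 < t" "t < 2 / 3" using u by (auto simp: t_def field_simps)
    have tD: "2 - 3 * t = 2 * v / D" using D v by (simp add: t_def u_def field_simps)
    have "t / 2 * v * (exp ((exp (2 * t) - 1) / 2) - 1) \<le> t / 2 * v * (2 * t / (2 - 3 * t))"
      using t v by (intro mult_left_mono double_exp_bound) auto
    also have "\<dots> = t * t * D / 2" unfolding tD using v D by simp
    also have "\<dots> = 2 / 9 * u\<^sup>2 / D"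
      unfolding t_def using u by (simp add: power2_eq_square)
    finally have "t / 2 * v * (exp ((exp (2 * t) - 1) / 2) - 1) - t * x \<le> 2 / 9 * u\<^sup>2 / D - t * x"
      by simp
    also have "2 / 9 * u\<^sup>2 / D - t * x = - (x\<^sup>2 / (v + D + 3 * x / 2))"
    proof -
      have "t * x = 2 / 9 * u\<^sup>2 * (w / (D * v))"
        unfolding t_def xu using v u by (simp add: power2_eq_square)
      also have "w / (D * v) = 1 / D + 1 / v"
        unfolding w_def using v u by (simp add: add_divide_distrib)
      finally have tx: "t * x = 2 / 9 * u\<^sup>2 * (1 / D + 1 / v)" .
      have "v + D + 3 * x / 2 = w + u * w / (2 * v)" by (simp add: xu w_def)
      also have "\<dots> = w * (2 * v + u) / (2 * v)" using v by (simp add: field_simps)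
      also have "2 * v + u = w" by (simp add: u_def w_def)
      finally have "x\<^sup>2 / (v + D + 3 * x / 2) = (u * w / (3 * v))\<^sup>2 / (w * w / (2 * v))"
        by (simp only: xu[symmetric])
      also have "\<dots> = 2 / 9 * u\<^sup>2 * (1 / v)"
        using v w by (simp add: power2_eq_square)
      finally show ?thesis by (simp add: tx distrib_left)
    qed
    finally have "t / 2 * v * (exp ((exp (2 * t) - 1) / 2) - 1) - t * x \<le> - (x\<^sup>2 / (v + D + 3 * x / 2))" .
    then have "exp (t / 2 * v * (exp ((exp (2 * t) - 1) / 2) - 1) - t * x) \<le> exp (- (x\<^sup>2 / (v + D + 3 * x / 2)))"
      by simp
    then show ?thesis using chernoff[OF t(1)] unfolding D_def by linarith
  qed (use zero in \<open>simp add: order_trans[of p 0]\<close>)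
qed

end

text \<open>\<open>v\<^sup>2 + 3 * v * x\<close> is \<open>(v + 3 * x / 2)\<^sup>2\<close> without
  its last square.\<close>

lemma bernstein_denominator_le:
  fixes v x :: real
  assumes "0 \<le> v" "0 < x"
  shows "exp (- (x\<^sup>2 / (v + sqrt (v\<^sup>2 + 3 * v * x) + 3 * x / 2))) \<le> exp (- (x\<^sup>2 / (2 * v + 3 * x)))"
proof -
  have "sqrt (v\<^sup>2 + 3 * v * x) \<le> v + 3 * x / 2"
    using assms by (intro real_le_lsqrt) (auto simp: power2_eq_square algebra_simps)
  moreover have "0 \<le> sqrt (v\<^sup>2 + 3 * v * x)" using assms by simp
  moreover from this have "0 < v + sqrt (v\<^sup>2 + 3 * v * x) + 3 * x / 2" using assms by linarith
  ultimately have "x\<^sup>2 / (2 * v + 3 * x) \<le> x\<^sup>2 / (v + sqrt (v\<^sup>2 + 3 * v * x) + 3 * x / 2)"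
    using assms by (intro divide_left_mono mult_pos_pos) auto
  then show ?thesis by simp
qed

section \<open>Countable classes\<close>

text \<open>Outside \<open>I\<close> the variables are replaced by a constant, so that
  \<open>D i\<close> is a probability measure for every index. For \<open>I = {}\<close> both sides
  are the point mass at the everywhere undefined function.\<close>

lemma (in prob_space) distr_restrict_eq_PiM:
  fixes X :: "'i \<Rightarrow> 'a \<Rightarrow> 'b" and I :: "'i set"
  assumes ind: "indep_vars (\<lambda>_. N) X I" and N: "space N \<noteq> {}" and I: "finite I"
  shows "\<exists>D. (\<forall>i. prob_space (D i)) \<and> (\<forall>i\<in>I. D i = distr M N (X i)) \<and>
           (\<forall>i. sets (D i) = sets N) \<and>
           distr M (Pi\<^sub>M I (\<lambda>_. N)) (\<lambda>\<omega>. \<lambda>i\<in>I. X i \<omega>) = Pi\<^sub>M I D"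
proof -
  obtain z where z: "z \<in> space N" using N by blast
  define Y where "Y i = (if i \<in> I then X i else (\<lambda>_. z))" for i
  have rv [measurable]: "random_variable N (Y i)" for i
    using ind z by (auto simp: Y_def indep_vars_def)
  define D where "D i = distr M N (Y i)" for i
  have prob: "prob_space (D i)" for i
    unfolding D_def by (intro prob_space_distr rv)
  have eqY: "(\<lambda>\<omega>. \<lambda>i\<in>I. X i \<omega>) = (\<lambda>\<omega>. \<lambda>i\<in>I. Y i \<omega>)"
    by (auto simp: Y_def fun_eq_iff)
  have "distr M (Pi\<^sub>M I (\<lambda>_. N)) (\<lambda>\<omega>. \<lambda>i\<in>I. Y i \<omega>) = Pi\<^sub>M I D"
  proof (cases "I = {}")
    case False
    have "indep_vars (\<lambda>_. N) Y I"
      by (rule indep_vars_cong[THEN iffD1, OF refl _ _ ind]) (simp_all add: Y_def)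
    then show ?thesis
      using indep_vars_iff_distr_eq_PiM[OF False, where M' = "\<lambda>_. N" and X = Y] by (simp add: D_def[abs_def] rv)
  next
    case True
    interpret D: prob_space "D i" for i by (rule prob)
    interpret D: product_prob_space D I by unfold_locales
    show ?thesis
    proof (rule D.PiM_eqI)
      show "sets (distr M (Pi\<^sub>M I (\<lambda>_. N)) (\<lambda>\<omega>. \<lambda>i\<in>I. Y i \<omega>)) = sets (Pi\<^sub>M I D)"
        using True by (simp add: PiM_empty)
      fix A
      show "emeasure (distr M (Pi\<^sub>M I (\<lambda>_. N)) (\<lambda>\<omega>. \<lambda>i\<in>I. Y i \<omega>)) (Pi\<^sub>E I A) = (\<Prod>i\<in>I. emeasure (D i) (A i))"
        using True by (subst emeasure_distr) (auto simp: PiM_empty emeasure_space_1 restrict_def)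
    qed (use I in auto)
  qed
  then show ?thesis
    unfolding eqY by (intro exI[of _ D]) (use prob in \<open>auto simp: D_def Y_def\<close>)
qed

section \<open>Uniform bounds for sums and suprema over a class\<close>

lemma component_classD:
  assumes "component_class n \<S>" "s \<in> \<S>" "k \<in> {1..n}"
  shows "s k \<in> borel_measurable borel" "\<bar>s k x\<bar> \<le> 1"
  using assms by (auto simp: component_class_def abs_le_iff minus_le_iff)

lemma abs_partial_sum_le:
  assumes "component_class n \<S>" "s \<in> \<S>"
  shows "\<bar>partial_sum n X s \<omega>\<bar> \<le> real n"
proof -
  have "\<bar>partial_sum n X s \<omega>\<bar> \<le> (\<Sum>k=1..n. \<bar>s k (X k \<omega>)\<bar>)"
    unfolding partial_sum_def by (rule sum_abs)
  also have "\<dots> \<le> (\<Sum>k=1..n. 1)"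
    by (intro sum_mono component_classD[OF assms])
  finally show ?thesis by simp
qed

lemma bdd_above_partial_sum:
  assumes "component_class n \<S>"
  shows "bdd_above ((\<lambda>s. partial_sum n X s \<omega>) ` \<S>)"
  by (rule bdd_aboveI2[where M = "real n"]) (rule abs_le_D1[OF abs_partial_sum_le[OF assms]])

lemma partial_sum_le_sup_sum:
  assumes "component_class n \<S>" "s \<in> \<S>"
  shows "partial_sum n X s \<omega> \<le> sup_sum n X \<S> \<omega>"
  unfolding sup_sum_def using assms by (intro cSUP_upper bdd_above_partial_sum)

lemma abs_sup_sum_le:
  assumes "component_class n \<S>"
  shows "\<bar>sup_sum n X \<S> \<omega>\<bar> \<le> real n"
proof -
  from assms obtain s where s: "s \<in> \<S>" by (auto simp: component_class_def)
  have "- real n \<le> sup_sum n X \<S> \<omega>"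
    using partial_sum_le_sup_sum[OF assms s, of X \<omega>] abs_partial_sum_le[OF assms s, of X \<omega>] by linarith
  moreover have "sup_sum n X \<S> \<omega> \<le> real n"
    unfolding sup_sum_def using s by (intro cSUP_least abs_le_D1[OF abs_partial_sum_le[OF assms]]) auto
  ultimately show ?thesis by simp
qed

lemma component_class_subset:
  "component_class n \<S> \<Longrightarrow> A \<subseteq> \<S> \<Longrightarrow> A \<noteq> {} \<Longrightarrow> component_class n A"
  by (auto simp: component_class_def countable_subset)

section \<open>From independent variables to the product space, and from finite to countable
  classes\<close>

context prob_space
begin

context
  fixes n :: nat and X :: "nat \<Rightarrow> 'a \<Rightarrow> 'b::topological_space" and \<S> :: "(nat \<Rightarrow> 'b \<Rightarrow> real) set"
  assumes ind: "indep_vars (\<lambda>_. borel) X {1..n}"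
    and class_S: "component_class n \<S>"
    and centered: "\<forall>s\<in>\<S>. \<forall>k\<in>{1..n}. expectation (\<lambda>\<omega>. s k (X k \<omega>)) = 0"
begin

lemma measurable_X: "k \<in> {1..n} \<Longrightarrow> X k \<in> M \<rightarrow>\<^sub>M borel"
  using ind by (auto simp: indep_vars_def)

lemma measurable_partial_sum: "s \<in> \<S> \<Longrightarrow> partial_sum n X s \<in> borel_measurable M"
  unfolding partial_sum_def[abs_def]
  by (intro borel_measurable_sum measurable_compose[OF measurable_X] component_classD(1)[OF class_S])

lemma integrable_component: "s \<in> \<S> \<Longrightarrow> k \<in> {1..n} \<Longrightarrow> integrable M (\<lambda>\<omega>. s k (X k \<omega>))"
  using component_classD[OF class_S]
  by (intro integrable_const_bound[where B = 1] measurable_compose[OF measurable_X]) auto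

lemma expectation_partial_sum: "s \<in> \<S> \<Longrightarrow> expectation (partial_sum n X s) = 0"
  unfolding partial_sum_def[abs_def]
  by (subst Bochner_Integration.integral_sum) (auto intro: integrable_component simp: centered)

text \<open>A real supremum dominates its members only if they are bounded above; here
  \<open>n\<^sup>2\<close> bounds every variance.\<close>

lemma variance_partial_sum_le:
  assumes "s \<in> \<S>"
  shows "variance (partial_sum n X s) \<le> max_variance M n X \<S>"
proof -
  have "variance (partial_sum n X s) \<le> (real n)\<^sup>2" if s: "s \<in> \<S>" for s
  proof -
    have b: "(partial_sum n X s \<omega>)\<^sup>2 \<le> (real n)\<^sup>2" for \<omega>
      using power_mono[OF abs_partial_sum_le[OF class_S s, of X \<omega>], of 2] by simp
    note [measurable] = measurable_partial_sum[OF s]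
    have "expectation (\<lambda>\<omega>. (partial_sum n X s \<omega>)\<^sup>2) \<le> expectation (\<lambda>_. (real n)\<^sup>2)"
      using b by (intro integral_mono integrable_const_bound[where B = "(real n)\<^sup>2"]) auto
    then show ?thesis by (simp add: expectation_partial_sum[OF s] prob_space)
  qed
  then show ?thesis unfolding max_variance_def using assms
    by (intro cSUP_upper bdd_aboveI[where M = "(real n)\<^sup>2"]) auto
qed

lemma max_variance_nonneg: "0 \<le> max_variance M n X \<S>"
proof -
  from class_S obtain s where s: "s \<in> \<S>" by (auto simp: component_class_def)
  have "0 \<le> variance (partial_sum n X s)" by simp
  with variance_partial_sum_le[OF s] show ?thesis by linarith
qed

text \<open>The joint law of the \<open>X k\<close> is a product measure, to which
  \<open>entropy_bound\<close> applies. The variance term is that of the whole class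
  \<open>\<S>\<close>, so it stays fixed while \<open>A\<close> grows.\<close>

lemma log_laplace_finite_class:
  assumes A: "finite A" "A \<noteq> {}" "A \<subseteq> \<S>" and t: "0 < t"
  shows "sup_sum n X A \<in> borel_measurable M"
    and "0 \<le> expectation (sup_sum n X A)"
    and "ln (expectation (\<lambda>\<omega>. exp (t * sup_sum n X A \<omega>))) \<le>
      t * expectation (sup_sum n X A) +
      t / 2 * (2 * expectation (sup_sum n X A) + max_variance M n X \<S>) * (exp ((exp (2 * t) - 1) / 2) - 1)"
proof -
  define I where "I = {1..n}"
  have fin: "finite I" and ne: "space (borel :: 'b measure) \<noteq> {}" by (simp_all add: I_def)
  obtain D where "(\<forall>i. prob_space (D i)) \<and> (\<forall>i\<in>I. D i = distr M borel (X i)) \<and>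
      (\<forall>i. sets (D i) = sets (borel :: 'b measure)) \<and>
      distr M (Pi\<^sub>M I (\<lambda>_. borel)) (\<lambda>\<omega>. \<lambda>i\<in>I. X i \<omega>) = Pi\<^sub>M I D"
    using distr_restrict_eq_PiM[OF ind[folded I_def] ne fin] by blast
  then have D: "\<And>i. prob_space (D i)" "\<And>i. i \<in> I \<Longrightarrow> D i = distr M borel (X i)"
    "\<And>i. sets (D i) = sets (borel :: 'b measure)"
    "distr M (Pi\<^sub>M I (\<lambda>_. borel)) (\<lambda>\<omega>. \<lambda>i\<in>I. X i \<omega>) = Pi\<^sub>M I D"
    by blast+
  have meas_D: "borel_measurable (D k) = borel_measurable borel" for k
    by (rule measurable_cong_sets[OF D(3) refl])
  interpret D: prob_space "D i" for i by (rule D(1))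
  interpret D: finite_product_prob_space D I
    by unfold_locales (rule fin)
  interpret C: finite_centered_class D I A
  proof unfold_locales
    show "finite A" "A \<noteq> {}" by fact+
    fix s k assume "s \<in> A" "k \<in> I"
    then have s: "s \<in> \<S>" "k \<in> {1..n}" and k: "k \<in> I" using A by (auto simp: I_def)
    show "s k \<in> borel_measurable (D k)"
      unfolding meas_D by (rule component_classD[OF class_S s])
    show "\<bar>s k y\<bar> \<le> 1" for y by (rule component_classD[OF class_S s])
    show "(\<integral>y. s k y \<partial>D k) = 0"
      unfolding D(2)[OF k]
      by (subst integral_distr[OF measurable_X[OF s(2)] component_classD(1)[OF class_S s]]) (rule centered[rule_format, OF s])
  qed
  define Y where "Y \<omega> = (\<lambda>i\<in>I. X i \<omega>)" for \<omega>
  have "Y \<in> M \<rightarrow>\<^sub>M Pi\<^sub>M I (\<lambda>_. borel)"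
    unfolding Y_def using measurable_X by (intro measurable_restrict) (auto simp: I_def)
  also have "measurable M (Pi\<^sub>M I (\<lambda>_. borel)) = measurable M (Pi\<^sub>M I D)"
    using D(3) by (intro measurable_cong_sets sets_PiM_cong) auto
  finally have Y [measurable]: "Y \<in> M \<rightarrow>\<^sub>M Pi\<^sub>M I D" .
  have "distr M (Pi\<^sub>M I D) Y = distr M (Pi\<^sub>M I (\<lambda>_. borel)) Y"
    using D(3) by (intro distr_cong sets_PiM_cong) auto
  also have "\<dots> = Pi\<^sub>M I D" using D(4) by (simp add: Y_def[abs_def])
  finally have distr: "distr M (Pi\<^sub>M I D) Y = Pi\<^sub>M I D" .
  have transfer: "expectation (\<lambda>\<omega>. \<phi> (Y \<omega>)) = (\<integral>x. \<phi> x \<partial>Pi\<^sub>M I D)"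
    if "\<phi> \<in> borel_measurable (Pi\<^sub>M I D)" for \<phi> :: "_ \<Rightarrow> real"
    using integral_distr[OF Y that] unfolding distr by (rule sym)
  note meas [measurable] = bounded_measurable_measurable[OF C.max_sum_bm]
  have T: "C.comp_sum s (Y \<omega>) = partial_sum n X s \<omega>" for s \<omega>
    unfolding C.comp_sum_def partial_sum_def I_def[symmetric] by (intro sum.cong) (auto simp: Y_def)
  have Z: "C.max_sum (Y \<omega>) = sup_sum n X A \<omega>" for \<omega>
    unfolding C.max_sum_def sup_sum_def T using A by (simp add: cSup_eq_Max)
  have EZ: "expectation (sup_sum n X A) = (\<integral>x. C.max_sum x \<partial>Pi\<^sub>M I D)"
    using transfer[of C.max_sum] by (simp add: Z)
  have V: "(\<Sum>k\<in>I. C.comp_var s k) \<le> max_variance M n X \<S>" if s: "s \<in> A" for s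
  proof -
    note [measurable] = bounded_measurable_measurable[OF C.comp_sum_bm[OF s]]
    have "variance (partial_sum n X s) = expectation (\<lambda>\<omega>. (C.comp_sum s (Y \<omega>))\<^sup>2)"
      using expectation_partial_sum s A by (auto simp: T)
    also have "\<dots> = (\<Sum>k\<in>I. C.comp_var s k)"
      by (subst transfer[of "\<lambda>x. (C.comp_sum s x)\<^sup>2"]) (auto simp: C.integral_comp_sum_square[OF s])
    finally show ?thesis using variance_partial_sum_le[of s] s A(3) by auto
  qed
  have FZ: "expectation (\<lambda>\<omega>. exp (u * sup_sum n X A \<omega>)) = (\<integral>x. exp (u * C.max_sum x) \<partial>Pi\<^sub>M I D)"
    "expectation (\<lambda>\<omega>. sup_sum n X A \<omega> * exp (u * sup_sum n X A \<omega>)) =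
      (\<integral>x. C.max_sum x * exp (u * C.max_sum x) \<partial>Pi\<^sub>M I D)" for u
    unfolding Z[symmetric] by (rule transfer; measurable)+
  show nonneg: "0 \<le> expectation (sup_sum n X A)"
    unfolding EZ by (rule C.integral_max_sum_nonneg)
  show measZ: "sup_sum n X A \<in> borel_measurable M"
    using measurable_compose[OF Y meas] by (simp add: Z)
  show "ln (expectation (\<lambda>\<omega>. exp (t * sup_sum n X A \<omega>))) \<le>
      t * expectation (sup_sum n X A) +
      t / 2 * (2 * expectation (sup_sum n X A) + max_variance M n X \<S>) * (exp ((exp (2 * t) - 1) / 2) - 1)"
  proof (rule log_laplace_from_entropy_bound[OF measZ _ nonneg _ t])
    show "\<bar>sup_sum n X A x\<bar> \<le> real n" for x
      by (rule abs_sup_sum_le[OF component_class_subset[OF class_S A(3,2)]])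
    fix u :: real assume u: "0 < u"
    show "(1 + u * exp u) * (u * expectation (\<lambda>x. sup_sum n X A x * exp (u * sup_sum n X A x)) -
          expectation (\<lambda>x. exp (u * sup_sum n X A x)) * ln (expectation (\<lambda>x. exp (u * sup_sum n X A x)))) \<le>
        u\<^sup>2 * exp u * expectation (\<lambda>x. sup_sum n X A x * exp (u * sup_sum n X A x)) +
        exp (2 * u) * u\<^sup>2 / 2 * max_variance M n X \<S> * expectation (\<lambda>x. exp (u * sup_sum n X A x))"
      unfolding FZ by (rule C.entropy_bound[OF u V])
  qed
qed

text \<open>A function whose sum exceeds \<open>y\<close> belongs to \<open>A m\<close> from its
  place in the enumeration on.\<close>

lemma sup_sum_approximation:
  defines "A m \<equiv> from_nat_into \<S> ` {..m}"
  shows "(\<lambda>m. sup_sum n X (A m) \<omega>) \<longlonglongrightarrow> sup_sum n X \<S> \<omega>"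
    and "sup_sum n X (A m) \<omega> \<le> sup_sum n X \<S> \<omega>"
    and "finite (A m)" "A m \<noteq> {}" "A m \<subseteq> \<S>"
proof -
  have S: "countable \<S>" "\<S> \<noteq> {}" using class_S by (auto simp: component_class_def)
  show A: "finite (A m)" "A m \<noteq> {}" "A m \<subseteq> \<S>" for m
    using S by (auto simp: A_def intro!: from_nat_into)
  show le: "sup_sum n X (A m) \<omega> \<le> sup_sum n X \<S> \<omega>" for m
    unfolding sup_sum_def using A by (intro cSUP_subset_mono bdd_above_partial_sum[OF class_S]) auto
  show "(\<lambda>m. sup_sum n X (A m) \<omega>) \<longlonglongrightarrow> sup_sum n X \<S> \<omega>"
  proof (rule order_tendstoI)
    fix y assume "y < sup_sum n X \<S> \<omega>"
    then have "\<exists>s\<in>\<S>. y < partial_sum n X s \<omega>"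
      unfolding sup_sum_def by (simp only: less_cSUP_iff[OF S(2) bdd_above_partial_sum[OF class_S]])
    then obtain s where s: "s \<in> \<S>" "y < partial_sum n X s \<omega>" by blast
    obtain i where i: "s = from_nat_into \<S> i"
      using from_nat_into_surj[OF S(1) s(1)] by blast
    have "y < sup_sum n X (A m) \<omega>" if "i \<le> m" for m
    proof -
      have "s \<in> A m" using that by (auto simp: A_def i)
      from partial_sum_le_sup_sum[OF component_class_subset[OF class_S A(3,2)] this] s(2)
      show ?thesis by (rule less_le_trans[rotated])
    qed
    then show "\<forall>\<^sub>F m in sequentially. y < sup_sum n X (A m) \<omega>"
      by (auto simp: eventually_sequentially)
  next
    fix y assume "sup_sum n X \<S> \<omega> < y"
    then show "\<forall>\<^sub>F m in sequentially. sup_sum n X (A m) \<omega> < y"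
      by (intro always_eventually allI le_less_trans[OF le])
  qed
qed

text \<open>The exponentials of the finite suprema are uniformly bounded, so dominated convergence
  passes to the limit on the left. On the right monotonicity suffices, giving a bound free of
  \<open>m\<close> before the limit.\<close>

lemma log_laplace_countable_class:
  shows "sup_sum n X \<S> \<in> borel_measurable M"
    and "0 \<le> expectation (sup_sum n X \<S>)"
    and "0 < t \<Longrightarrow> ln (expectation (\<lambda>\<omega>. exp (t * sup_sum n X \<S> \<omega>))) \<le>
      t * expectation (sup_sum n X \<S>) +
      t / 2 * (2 * expectation (sup_sum n X \<S>) + max_variance M n X \<S>) * (exp ((exp (2 * t) - 1) / 2) - 1)"
proof -
  define A where "A m = from_nat_into \<S> ` {..m}" for m
  note approx = sup_sum_approximation[folded A_def]
  have meas_A [measurable]: "sup_sum n X (A m) \<in> borel_measurable M" for m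
    by (rule log_laplace_finite_class(1)[OF approx(3-5) zero_less_one])
  show meas [measurable]: "sup_sum n X \<S> \<in> borel_measurable M"
    by (rule borel_measurable_LIMSEQ_real[OF approx(1) meas_A])
  have bound_A: "\<bar>sup_sum n X (A m) \<omega>\<bar> \<le> real n" for m \<omega>
    by (rule abs_sup_sum_le[OF component_class_subset[OF class_S approx(5,4)]])
  have bound_S: "\<bar>sup_sum n X \<S> \<omega>\<bar> \<le> real n" for \<omega>
    by (rule abs_sup_sum_le[OF class_S])
  have int: "integrable M (sup_sum n X \<S>)" "integrable M (sup_sum n X (A m))" for m
    using bound_A bound_S by (auto intro!: integrable_const_bound[where B = "real n"])
  have E_le: "expectation (sup_sum n X (A m)) \<le> expectation (sup_sum n X \<S>)" for m
    by (intro integral_mono int approx(2))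
  show "0 \<le> expectation (sup_sum n X \<S>)"
    using log_laplace_finite_class(2)[OF approx(3-5) zero_less_one, of 0] E_le[of 0] by linarith
  show "ln (expectation (\<lambda>\<omega>. exp (t * sup_sum n X \<S> \<omega>))) \<le>
      t * expectation (sup_sum n X \<S>) +
      t / 2 * (2 * expectation (sup_sum n X \<S>) + max_variance M n X \<S>) * (exp ((exp (2 * t) - 1) / 2) - 1)"
    (is "_ \<le> ?R") if t: "0 < t"
  proof -
    have bound_exp: "exp (t * z) \<le> exp (t * real n)" if "\<bar>z\<bar> \<le> real n" for z
      using that t by auto
    have int_exp: "integrable M (\<lambda>\<omega>. exp (t * sup_sum n X \<S> \<omega>))" "integrable M (\<lambda>\<omega>. exp (t * sup_sum n X (A m) \<omega>))" for m
      using bound_A bound_S bound_exp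
      by (auto intro!: integrable_const_bound[where B = "exp (t * real n)"])
    have pos: "0 < expectation (\<lambda>\<omega>. exp (t * Z \<omega>))" if "integrable M (\<lambda>\<omega>. exp (t * Z \<omega>))" "\<And>\<omega>. \<bar>Z \<omega>\<bar> \<le> real n" for Z
    proof -
      have "expectation (\<lambda>_. exp (- (t * real n))) \<le> expectation (\<lambda>\<omega>. exp (t * Z \<omega>))"
      proof (intro integral_mono that)
        fix \<omega>
        have "t * (- real n) \<le> t * Z \<omega>"
          using t that(2)[of \<omega>] by (intro mult_left_mono) auto
        then show "exp (- (t * real n)) \<le> exp (t * Z \<omega>)" by simp
      qed simp
      then show ?thesis by (simp add: prob_space) (meson exp_gt_zero less_le_trans)
    qed
    have "expectation (\<lambda>\<omega>. exp (t * sup_sum n X (A m) \<omega>)) \<le> exp ?R" for m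
    proof -
      have "ln (expectation (\<lambda>\<omega>. exp (t * sup_sum n X (A m) \<omega>))) \<le>
        t * expectation (sup_sum n X (A m)) +
        t / 2 * (2 * expectation (sup_sum n X (A m)) + max_variance M n X \<S>) * (exp ((exp (2 * t) - 1) / 2) - 1)"
        by (rule log_laplace_finite_class(3)[OF approx(3-5) t])
      \<comment> \<open>The right side increases with the mean, as
        \<open>exp ((exp (2 * t) - 1) / 2) \<ge> 1\<close>.\<close>
      also have "\<dots> \<le> ?R"
        using t E_le[of m] by (intro add_mono mult_left_mono mult_right_mono) auto
      finally have "exp (ln (expectation (\<lambda>\<omega>. exp (t * sup_sum n X (A m) \<omega>)))) \<le> exp ?R" by simp
      then show ?thesis by (simp only: exp_ln[OF pos[OF int_exp(2) bound_A]])
    qed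
    moreover have "(\<lambda>m. expectation (\<lambda>\<omega>. exp (t * sup_sum n X (A m) \<omega>))) \<longlonglongrightarrow> expectation (\<lambda>\<omega>. exp (t * sup_sum n X \<S> \<omega>))"
      by (rule integral_dominated_convergence[where w = "\<lambda>_. exp (t * real n)"])
        (use bound_A bound_exp in \<open>auto intro!: tendsto_intros approx(1)\<close>)
    ultimately have "expectation (\<lambda>\<omega>. exp (t * sup_sum n X \<S> \<omega>)) \<le> exp ?R"
      by (intro LIMSEQ_le_const2) auto
    then have "ln (expectation (\<lambda>\<omega>. exp (t * sup_sum n X \<S> \<omega>))) \<le> ln (exp ?R)"
      using pos[OF int_exp(1) bound_S] by (subst ln_le_cancel_iff) auto
    then show ?thesis by simp
  qed
qed

end

end

theorem theorem1p1:
  fixes M :: "'w measure"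
    and n :: nat
    and X :: "nat \<Rightarrow> 'w \<Rightarrow> 'a::polish_space"
    and \<S> :: "(nat \<Rightarrow> 'a \<Rightarrow> real) set"
  assumes "prob_space M"
    and "prob_space.indep_vars M (\<lambda>_. borel) X {1..n}"
    and "component_class n \<S>"
    and "\<And>s k. s \<in> \<S> \<Longrightarrow> k \<in> {1..n} \<Longrightarrow> prob_space.expectation M (\<lambda>\<omega>. s k (X k \<omega>)) = 0"
  shows "let Z = sup_sum n X \<S>;
             EZ = prob_space.expectation M Z;
             V = max_variance M n X \<S>;
             L = log_laplace M Z;
             v = 2 * EZ + V
         in
           (\<forall>t>0. L t \<le> t * EZ + t / 2 * (2 * EZ + V) * (exp ((exp (2 * t) - 1) / 2) - 1)) \<and>
           (\<forall>x>0. measure M {\<omega> \<in> space M. Z \<omega> \<ge> EZ + x} \<le>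
                   (if v = 0 then 0 else exp (- (x / 4) * ln (1 + 2 * ln (1 + x / v))))) \<and>
           (\<forall>x>0. measure M {\<omega> \<in> space M. Z \<omega> \<ge> EZ + x} \<le>
                     exp (- (x\<^sup>2 / (v + sqrt (v\<^sup>2 + 3 * v * x) + 3 * x / 2))) \<and>
                   exp (- (x\<^sup>2 / (v + sqrt (v\<^sup>2 + 3 * v * x) + 3 * x / 2))) \<le>
                     exp (- (x\<^sup>2 / (2 * v + 3 * x))))"
proof -
  interpret prob_space M by fact
  have centered: "\<forall>s\<in>\<S>. \<forall>k\<in>{1..n}. expectation (\<lambda>\<omega>. s k (X k \<omega>)) = 0"
    using assms(4) by blast
  note * = log_laplace_countable_class[OF assms(2,3) centered]
  have v: "0 \<le> 2 * expectation (sup_sum n X \<S>) + max_variance M n X \<S>"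
    using *(2) max_variance_nonneg[OF assms(2,3) centered] by simp
  note dev = deviation_from_log_laplace[OF *(1) abs_sup_sum_le[OF assms(3)] *(3) v]
  show ?thesis
    unfolding Let_def log_laplace_def
    by (intro conjI allI impI *(3) dev bernstein_denominator_le[OF v])
qed

end
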